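(* Let $G = F_2\rtimes F_n$, where $n\ge 2$ and $F_j$ denotes the free group of rank $j$. Then $G$ is incoherent. Moreover, $G$ virtually algebraically fibers, i.e. $G$ has a finite-index subgroup that algebraically fibers.
   Context: A group is coherent if every finitely generated subgroup is finitely presented, and incoherent otherwise. A group $A$ algebraically fibers if there is a surjective homomorphism $A\to\mathbb{Z}$ with finitely generated kernel. *)

theory Defs
  imports "HOL-Algebra.Bij" "HOL-Algebra.Elementary_Groups"
begin

section \<open>Free groups\<close>

text \<open>The letter \<open>(x, True)\<close> stands for the generator \<open>x\<close> and \<open>(x, False)\<close> for its
  formal inverse. Elements of a free group are reduced words.\<close>

type_synonym 'a word = "('a \<times> bool) list"

definition inv_letter :: "'a \<times> bool \<Rightarrow> 'a \<times> bool" where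
  "inv_letter a = (fst a, \<not> snd a)"

definition reduced :: "'a word \<Rightarrow> bool" where
  "reduced w \<longleftrightarrow> successively (\<lambda>a b. b \<noteq> inv_letter a) w"

text \<open>\<open>push a w\<close> is the reduced form of \<open>a # w\<close>, for reduced \<open>w\<close>.\<close>

fun push :: "'a \<times> bool \<Rightarrow> 'a word \<Rightarrow> 'a word" where
  "push a [] = [a]"
| "push a (b # w) = (if b = inv_letter a then w else a # b # w)"

definition free_group :: "'a set \<Rightarrow> 'a word monoid" where
  "free_group X =
    \<lparr>carrier = {w. reduced w \<and> fst ` set w \<subseteq> X},
     mult = (\<lambda>v w. foldr push v w),
     one = []\<rparr>"

lemma inv_letter_inv_letter [simp]: "inv_letter (inv_letter a) = a"
  by (simp add: inv_letter_def)

lemma fst_inv_letter [simp]: "fst (inv_letter a) = fst a"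
  by (simp add: inv_letter_def)

lemma inv_letter_neq [simp]: "inv_letter a \<noteq> a"
  by (metis inv_letter_def snd_conv)

lemma reduced_Nil [simp]: "reduced []"
  by (simp add: reduced_def)

lemma reduced_tl: "reduced (a # w) \<Longrightarrow> reduced w"
  by (cases w) (auto simp: reduced_def)

lemma reduced_push: "reduced w \<Longrightarrow> reduced (push a w)"
  by (cases w) (auto simp: reduced_def successively_Cons)

lemma push_reduced: "reduced (a # w) \<Longrightarrow> push a w = a # w"
  by (cases w) (auto simp: reduced_def)

lemma push_cancel: "reduced w \<Longrightarrow> push a (push (inv_letter a) w) = w"
  by (cases w) (auto dest: push_reduced)

lemma set_push: "set (push a w) \<subseteq> insert a (set w)"
  by (cases w) auto

lemma reduced_foldr_push: "reduced w \<Longrightarrow> reduced (foldr push v w)"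
  by (induction v) (auto intro: reduced_push)

lemma set_foldr_push: "set (foldr push v w) \<subseteq> set v \<union> set w"
proof (induction v)
  case (Cons a v)
  then show ?case using set_push[of a "foldr push v w"] by auto
qed simp

lemma foldr_push_push:
  assumes "reduced u" shows "foldr push (push a w) u = push a (foldr push w u)"
proof (cases w)
  case (Cons b w')
  then show ?thesis
    using push_cancel[OF reduced_foldr_push[OF assms], of a w'] by auto
qed simp

lemma foldr_push_assoc:
  "reduced u \<Longrightarrow> foldr push (foldr push v w) u = foldr push v (foldr push w u)"
  by (induction v) (auto simp: foldr_push_push)

lemma foldr_push_inverse: "foldr push (rev (map inv_letter v)) v = []"
  by (induction v) auto

lemma foldr_push_Nil: "reduced v \<Longrightarrow> foldr push v [] = v"
  by (induction v) (simp_all add: reduced_tl push_reduced)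

lemma reduced_inverse: "reduced v \<Longrightarrow> reduced (rev (map inv_letter v))"
  by (auto simp: reduced_def successively_map elim!: successively_mono)

theorem group_free_group: "group (free_group X)"
proof (rule groupI)
  fix v w assume "v \<in> carrier (free_group X)" "w \<in> carrier (free_group X)"
  then show "v \<otimes>\<^bsub>free_group X\<^esub> w \<in> carrier (free_group X)"
    using set_foldr_push[of v w] by (fastforce simp: free_group_def reduced_foldr_push)
next
  fix v assume v: "v \<in> carrier (free_group X)"
  then have "rev (map inv_letter v) \<in> carrier (free_group X)"
    by (auto simp: free_group_def reduced_inverse)
  then show "\<exists>w\<in>carrier (free_group X). w \<otimes>\<^bsub>free_group X\<^esub> v = \<one>\<^bsub>free_group X\<^esub>"
    by (rule bexI[rotated]) (simp add: free_group_def foldr_push_inverse)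
qed (auto simp: free_group_def foldr_push_assoc)

definition gen :: "'a \<Rightarrow> 'a word" where
  "gen x = [(x, True)]"

lemma gen_closed: "x \<in> X \<Longrightarrow> gen x \<in> carrier (free_group X)"
  by (simp add: gen_def free_group_def reduced_def)

lemma inv_gen: "x \<in> X \<Longrightarrow> inv\<^bsub>free_group X\<^esub> (gen x) = [(x, False)]"
  by (rule group.inv_equality[OF group_free_group])
     (auto simp: gen_def free_group_def reduced_def inv_letter_def)

theorem generate_gen: "generate (free_group X) (gen ` X) = carrier (free_group X)"
proof
  show "generate (free_group X) (gen ` X) \<subseteq> carrier (free_group X)"
    by (intro group.generate_incl[OF group_free_group]) (auto intro: gen_closed)
  show "carrier (free_group X) \<subseteq> generate (free_group X) (gen ` X)"
  proof
    fix w assume "w \<in> carrier (free_group X)"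
    then show "w \<in> generate (free_group X) (gen ` X)"
    proof (induction w)
      case Nil
      then show ?case using generate.one[of "free_group X"] by (simp add: free_group_def)
    next
      case (Cons a w)
      obtain x b where a: "a = (x, b)" by force
      have x: "x \<in> X" and red: "reduced (a # w)" and w: "w \<in> carrier (free_group X)"
        using Cons.prems a by (auto simp: free_group_def dest: reduced_tl)
      have "[a] \<in> generate (free_group X) (gen ` X)"
      proof (cases b)
        case True
        then show ?thesis using x a generate.incl[of "gen x" "gen ` X"] by (auto simp: gen_def)
      next
        case False
        then show ?thesis
          using x a inv_gen[OF x] generate.inv[of "gen x" "gen ` X" "free_group X"] by auto
      qed
      then have "[a] \<otimes>\<^bsub>free_group X\<^esub> w \<in> generate (free_group X) (gen ` X)"
        using Cons.IH[OF w] by (rule generate.eng)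
      then show ?case using push_reduced[OF red] by (simp add: free_group_def)
    qed
  qed
qed

text \<open>The universal property. Uniqueness of the extension on the carrier follows from
  \<open>generate_gen\<close>.\<close>

theorem (in group) free_group_universal:
  assumes f: "f \<in> X \<rightarrow> carrier G"
  shows "\<exists>h \<in> hom (free_group X) G. \<forall>x\<in>X. h (gen x) = f x"
proof -
  define l where "l a = (if snd a then f (fst a) else inv (f (fst a)))" for a
  define h where "h w = foldr (\<lambda>a g. l a \<otimes> g) w \<one>" for w
  have l: "l a \<in> carrier G" "l (inv_letter a) = inv (l a)" if "fst a \<in> X" for a
    using Pi_mem[OF f that] by (auto simp: l_def inv_letter_def)
  have h: "h w \<in> carrier G" if "fst ` set w \<subseteq> X" for w
    using that by (induction w) (auto simp: h_def l)
  have push: "h (push a w) = l a \<otimes> h w" if "fst a \<in> X" "fst ` set w \<subseteq> X" for a w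
  proof (cases w)
    case (Cons b w')
    have "h w' \<in> carrier G" using that Cons by (intro h) auto
    then have "l a \<otimes> (inv (l a) \<otimes> h w') = h w'"
      using l(1)[OF that(1)] by (simp add: m_assoc[symmetric])
    then show ?thesis using Cons l(2)[OF that(1)] by (auto simp: h_def)
  qed (simp add: h_def)
  have mult: "h (foldr push v w) = h v \<otimes> h w" if "fst ` set v \<subseteq> X" "fst ` set w \<subseteq> X" for v w
    using that
  proof (induction v)
    case Nil
    then show ?case by (simp add: h[unfolded h_def] h_def)
  next
    case (Cons a v)
    have "fst ` set (foldr push v w) \<subseteq> X"
      using Cons.prems set_foldr_push[of v w] by fastforce
    then have "h (foldr push (a # v) w) = l a \<otimes> (h v \<otimes> h w)"
      using Cons push by simp
    also have "\<dots> = h (a # v) \<otimes> h w"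
      using Cons.prems l(1) h[of v] h[of w] by (simp add: h_def m_assoc)
    finally show ?case .
  qed
  have "h \<in> hom (free_group X) G"
    by (auto simp: hom_def free_group_def mult h)
  moreover have "h (gen x) = f x" if "x \<in> X" for x
    using Pi_mem[OF f that] by (simp add: h_def l_def gen_def)
  ultimately show ?thesis by blast
qed


section \<open>Semidirect products\<close>

text \<open>For \<open>\<phi> \<in> hom H (AutoGroup N)\<close>, the group \<open>N \<rtimes> H\<close> with \<open>h n h\<inverse> = \<phi> h n\<close>.\<close>

definition semidirect ::
    "('a, 'c) monoid_scheme \<Rightarrow> ('b \<Rightarrow> 'a \<Rightarrow> 'a) \<Rightarrow> ('b, 'd) monoid_scheme \<Rightarrow> ('a \<times> 'b) monoid" where
  "semidirect N \<phi> H =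
    \<lparr>carrier = carrier N \<times> carrier H,
     mult = (\<lambda>(a, b) (a', b'). (a \<otimes>\<^bsub>N\<^esub> \<phi> b a', b \<otimes>\<^bsub>H\<^esub> b')),
     one = (\<one>\<^bsub>N\<^esub>, \<one>\<^bsub>H\<^esub>)\<rparr>"

theorem group_semidirect:
  assumes "group N" "group H" and \<phi>: "\<phi> \<in> hom H (AutoGroup N)"
  shows "group (semidirect N \<phi> H)"
proof -
  interpret N: group N by fact
  interpret H: group H by fact
  have au: "\<phi> b \<in> hom N N" "\<phi> b \<in> Bij (carrier N)" if "b \<in> carrier H" for b
    using \<phi> that by (auto simp: hom_def[of H] AutoGroup_def auto_def)
  have cl: "\<phi> b x \<in> carrier N" if "b \<in> carrier H" "x \<in> carrier N" for b x
    using au(1)[OF that(1)] that(2) by (rule hom_in_carrier)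
  have hm: "\<phi> b (x \<otimes>\<^bsub>N\<^esub> y) = \<phi> b x \<otimes>\<^bsub>N\<^esub> \<phi> b y"
    if "b \<in> carrier H" "x \<in> carrier N" "y \<in> carrier N" for b x y
    using au(1)[OF that(1)] that(2,3) by (rule hom_mult)
  have act: "\<phi> (b \<otimes>\<^bsub>H\<^esub> c) x = \<phi> b (\<phi> c x)"
    if "b \<in> carrier H" "c \<in> carrier H" "x \<in> carrier N" for b c x
    using hom_mult[OF \<phi> that(1,2)] au(2)[OF that(1)] au(2)[OF that(2)] that(3)
    by (simp add: AutoGroup_def BijGroup_def compose_def)
  have one: "\<phi> \<one>\<^bsub>H\<^esub> x = x" if x: "x \<in> carrier N" for x
  proof -
    have "\<phi> \<one>\<^bsub>H\<^esub> (\<phi> \<one>\<^bsub>H\<^esub> x) = \<phi> \<one>\<^bsub>H\<^esub> x" using act[of "\<one>\<^bsub>H\<^esub>" "\<one>\<^bsub>H\<^esub>" x] x by simp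
    moreover have "inj_on (\<phi> \<one>\<^bsub>H\<^esub>) (carrier N)"
      using au(2)[of "\<one>\<^bsub>H\<^esub>"] by (auto simp: Bij_def bij_betw_def)
    ultimately show ?thesis using x cl[of "\<one>\<^bsub>H\<^esub>" x] by (meson H.one_closed inj_onD)
  qed
  show ?thesis
  proof (rule groupI)
    fix x assume x: "x \<in> carrier (semidirect N \<phi> H)"
    then obtain a b where ab: "x = (a, b)" "a \<in> carrier N" "b \<in> carrier H"
      by (auto simp: semidirect_def)
    have "\<phi> (inv\<^bsub>H\<^esub> b) (inv\<^bsub>N\<^esub> a) \<otimes>\<^bsub>N\<^esub> \<phi> (inv\<^bsub>H\<^esub> b) a = \<phi> (inv\<^bsub>H\<^esub> b) \<one>\<^bsub>N\<^esub>"
      using ab hm[of "inv\<^bsub>H\<^esub> b" "inv\<^bsub>N\<^esub> a" a] by simp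
    also have "\<dots> = \<one>\<^bsub>N\<^esub>"
      using ab au(1)[of "inv\<^bsub>H\<^esub> b"] by (intro hom_one) (simp_all add: N.is_group)
    finally show "\<exists>y\<in>carrier (semidirect N \<phi> H). y \<otimes>\<^bsub>semidirect N \<phi> H\<^esub> x = \<one>\<^bsub>semidirect N \<phi> H\<^esub>"
      using ab cl by (intro bexI[of _ "(\<phi> (inv\<^bsub>H\<^esub> b) (inv\<^bsub>N\<^esub> a), inv\<^bsub>H\<^esub> b)"])
        (auto simp: semidirect_def)
  qed (auto simp: semidirect_def cl hm act one N.m_assoc H.m_assoc)
qed


section \<open>Finiteness properties\<close>

definition finitely_generated :: "('a, 'b) monoid_scheme \<Rightarrow> bool" where
  "finitely_generated G \<longleftrightarrow> (\<exists>S. finite S \<and> S \<subseteq> carrier G \<and> generate G S = carrier G)"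

definition normal_closure :: "('a, 'b) monoid_scheme \<Rightarrow> 'a set \<Rightarrow> 'a set" where
  "normal_closure G R = generate G {g \<otimes>\<^bsub>G\<^esub> r \<otimes>\<^bsub>G\<^esub> inv\<^bsub>G\<^esub> g | g r. g \<in> carrier G \<and> r \<in> R}"

lemma (in group) normal_closure_normal:
  assumes "R \<subseteq> carrier G" shows "normal_closure G R \<lhd> G"
  unfolding normal_closure_def
proof (rule normal_generateI)
  let ?C = "{g \<otimes> r \<otimes> inv g | g r. g \<in> carrier G \<and> r \<in> R}"
  show "?C \<subseteq> carrier G" using assms by auto
  fix h g assume "h \<in> ?C" and g: "g \<in> carrier G"
  then obtain k r where "h = k \<otimes> r \<otimes> inv k" "k \<in> carrier G" "r \<in> R" by auto
  moreover from this g have "g \<otimes> h \<otimes> inv g = (g \<otimes> k) \<otimes> r \<otimes> inv (g \<otimes> k)"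
    using assms by (auto simp: m_assoc inv_mult_group subset_iff)
  ultimately show "g \<otimes> h \<otimes> inv g \<in> ?C" using g by blast
qed

definition finitely_presented :: "('a, 'b) monoid_scheme \<Rightarrow> bool" where
  "finitely_presented G \<longleftrightarrow>
    (\<exists>(n::nat) R. finite R \<and> R \<subseteq> carrier (free_group {..<n}) \<and>
      G \<cong> free_group {..<n} Mod normal_closure (free_group {..<n}) R)"

definition coherent :: "('a, 'b) monoid_scheme \<Rightarrow> bool" where
  "coherent G \<longleftrightarrow>
    (\<forall>H. subgroup H G \<and> finitely_generated (G\<lparr>carrier := H\<rparr>)
      \<longrightarrow> finitely_presented (G\<lparr>carrier := H\<rparr>))"

abbreviation incoherent :: "('a, 'b) monoid_scheme \<Rightarrow> bool" where
  "incoherent G \<equiv> \<not> coherent G"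

definition algebraically_fibers :: "('a, 'b) monoid_scheme \<Rightarrow> bool" where
  "algebraically_fibers A \<longleftrightarrow>
    (\<exists>f \<in> epi A integer_group.
      finitely_generated (A\<lparr>carrier := kernel A integer_group f\<rparr>))"

definition virtually_algebraically_fibers :: "('a, 'b) monoid_scheme \<Rightarrow> bool" where
  "virtually_algebraically_fibers G \<longleftrightarrow>
    (\<exists>H. subgroup H G \<and> finite (rcosets\<^bsub>G\<^esub> H) \<and> algebraically_fibers (G\<lparr>carrier := H\<rparr>))"

end

theory Submission
  imports Defs
begin

text \<open>
  Write \<open>F\<^sub>2 = \<langle>a, b\<rangle>\<close>. The proof finds, in a subgroup of finite index, a character that does not
  vanish on the fibre (excess homology), and exploits it twice.

  \<^bold>\<open>An invariant character.\<close> Let \<open>sgn_hom\<close> be the character of \<open>F\<^sub>2\<close> with \<open>a \<mapsto> -1\<close>,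
  \<open>b \<mapsto> 1\<close>, let \<open>L\<close> be its kernel, and let \<open>shift\<close> be the crossed homomorphism to the integers
  twisted by \<open>sgn_hom\<close> with \<open>a \<mapsto> 0\<close>, \<open>b \<mapsto> 1\<close>. The two are the components of the map of \<open>F\<^sub>2\<close> onto
  the infinite dihedral group that sends \<open>a\<close> to a reflection and \<open>b\<close> to a translation. On
  \<open>L\<close>, \<open>shift\<close> is a homomorphism. The twisted cohomology group in which its class lives has
  rank one, so an automorphism of \<open>F\<^sub>2\<close> that preserves \<open>sgn_hom\<close> can change \<open>shift\<close> on \<open>L\<close> only by a
  sign (\<open>shift_automorphism\<close>). As \<open>F\<^sub>2\<close> has only finitely many characters with values \<open>\<plusminus>1\<close>, a
  subgroup \<open>Q\<close> of finite index in \<open>F\<^sub>n\<close> fixes both (\<open>shift_stab_finite_index\<close>), and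
  \<open>F(l, q) = shift l\<close> is a homomorphism on \<open>L \<rtimes> Q\<close>.

  \<^bold>\<open>Fibering.\<close> Let \<open>M = L \<inter> ker F\<close>, let \<open>\<tau>\<close> be the exponent sum on \<open>Q\<close>, and consider \<open>F + c \<tau>\<close>. Its
  kernel is generated by \<open>M\<close> and by corrections \<open>u = t s\<^sup>-\<^sup>k\<close> of the generators \<open>t\<close> of \<open>Q\<close>, where \<open>s \<in> L\<close>
  has \<open>F s = 1\<close> (\<open>kernel_generators\<close>). The group \<open>M\<close> is a union of finitely generated windows along an axis translated by
  \<open>s\<close>. Conjugation by \<open>t\<close> distorts a window by a bounded amount, while for large \<open>c\<close> the
  power of \<open>s\<close> moves it farther than that; hence a single \<open>u\<close> and one finite window generate
  \<open>M\<close> (\<open>sweep\<close>). This is an elementary form of the openness of the Bieri-Neumann-Strebel invariant.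
  So the kernel is finitely generated, and \<open>L \<rtimes> Q\<close> algebraically fibers.

  \<^bold>\<open>Incoherence.\<close> Replace \<open>Q\<close> by the free subgroup generated by suitable powers of two basis
  elements of \<open>F\<^sub>n\<close>. The kernel of \<open>F + c \<tau>\<close> is again finitely generated; it is an amalgam over \<open>M\<close> of
  the two groups \<open>\<langle>M, u\<rangle>\<close>, which are finitely generated for the same reason. But \<open>M\<close>, the kernel
  of the map from \<open>F\<^sub>2\<close> to the dihedral group, is not finitely generated: it has infinitely many
  independent elements \<open>b\<^sup>j a\<^sup>2 b\<^sup>-\<^sup>j\<close>, as a wreath product detects
  (\<open>dihedral_ker_not_finitely_generated\<close>). An amalgam of finitely generated groups over a group that is
  not finitely generated is not finitely presented (\<open>finitely_generated_edge_group\<close>).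
\<close>

section \<open>Conjugation and generated subgroups\<close>

context group
begin

lemma inv_cancel_left [simp]:
  "x \<in> carrier G \<Longrightarrow> y \<in> carrier G \<Longrightarrow> x \<otimes> (inv x \<otimes> y) = y"
  "x \<in> carrier G \<Longrightarrow> y \<in> carrier G \<Longrightarrow> inv x \<otimes> (x \<otimes> y) = y"
  by (simp_all flip: m_assoc)

lemma generate_closed:
  assumes "A \<subseteq> carrier G"
  shows "\<And>x y. x \<in> generate G A \<Longrightarrow> y \<in> generate G A \<Longrightarrow> x \<otimes> y \<in> generate G A"
    "\<And>x. x \<in> generate G A \<Longrightarrow> inv x \<in> generate G A"
  using assms by (auto intro: generate.eng generate_m_inv_closed)

definition conj_by :: "'a \<Rightarrow> 'a \<Rightarrow> 'a" where
  "conj_by g x = g \<otimes> x \<otimes> inv g"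

lemma conj_by_closed [simp]: "g \<in> carrier G \<Longrightarrow> x \<in> carrier G \<Longrightarrow> conj_by g x \<in> carrier G"
  by (simp add: conj_by_def)

lemma conj_by_mult:
  "g \<in> carrier G \<Longrightarrow> x \<in> carrier G \<Longrightarrow> y \<in> carrier G \<Longrightarrow>
    conj_by g (x \<otimes> y) = conj_by g x \<otimes> conj_by g y"
  by (simp add: conj_by_def m_assoc)

lemma conj_by_inv:
  "g \<in> carrier G \<Longrightarrow> x \<in> carrier G \<Longrightarrow> conj_by g (inv x) = inv (conj_by g x)"
  by (simp add: conj_by_def m_assoc inv_mult_group)

lemma conj_by_conj_by:
  "g \<in> carrier G \<Longrightarrow> h \<in> carrier G \<Longrightarrow> x \<in> carrier G \<Longrightarrow>
    conj_by g (conj_by h x) = conj_by (g \<otimes> h) x"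
  by (simp add: conj_by_def m_assoc inv_mult_group)

lemma conj_by_one [simp]: "x \<in> carrier G \<Longrightarrow> conj_by \<one> x = x" "g \<in> carrier G \<Longrightarrow> conj_by g \<one> = \<one>"
  by (simp_all add: conj_by_def)

lemma conj_by_generate:
  assumes A: "A \<subseteq> carrier G" and B: "B \<subseteq> carrier G" and g: "g \<in> carrier G"
    and AB: "\<And>a. a \<in> A \<Longrightarrow> conj_by g a \<in> generate G B"
    and x: "x \<in> generate G A"
  shows "conj_by g x \<in> generate G B"
  using x
proof (induction rule: generate.induct)
  case (inv h)
  then show ?case
    using AB[of h] generate_closed(2)[OF B] A g by (auto simp: conj_by_inv subset_iff)
next
  case (eng x y)
  then show ?case
    using generate_closed(1)[OF B] generate_incl[OF A] g by (auto simp: conj_by_mult subset_iff)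
qed (auto simp: AB g generate.one)

section \<open>Sweeping out a subgroup by one element\<close>

definition pow_conjs :: "'a \<Rightarrow> 'a set \<Rightarrow> int set \<Rightarrow> 'a set" where
  "pow_conjs s Y J = (\<lambda>(j, y). conj_by (s [^] j) y) ` (J \<times> Y)"

lemma pow_conjs_closed: "s \<in> carrier G \<Longrightarrow> Y \<subseteq> carrier G \<Longrightarrow> pow_conjs s Y J \<subseteq> carrier G"
  by (auto simp: pow_conjs_def)

lemma pow_conjs_mono: "I \<subseteq> J \<Longrightarrow> pow_conjs s Y I \<subseteq> pow_conjs s Y J"
  by (auto simp: pow_conjs_def)

lemma pow_conjsI: "j \<in> J \<Longrightarrow> y \<in> Y \<Longrightarrow> conj_by (s [^] j) y \<in> pow_conjs s Y J"
  by (auto simp: pow_conjs_def)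

lemma pow_conjsE:
  assumes "x \<in> pow_conjs s Y J"
  obtains j y where "x = conj_by (s [^] j) y" "j \<in> J" "y \<in> Y"
  using assms by (auto simp: pow_conjs_def)

lemma generate_pow_conjs_mono:
  "I \<subseteq> J \<Longrightarrow> x \<in> generate G (pow_conjs s Y I) \<Longrightarrow> x \<in> generate G (pow_conjs s Y J)"
  using mono_generate[OF pow_conjs_mono] by blast

lemma generate_pow_conjs_shift:
  assumes s: "s \<in> carrier G" and Y: "Y \<subseteq> carrier G"
    and x: "x \<in> generate G (pow_conjs s Y I)" and J: "(\<lambda>j. j + i) ` I \<subseteq> J"
  shows "conj_by (s [^] (i::int)) x \<in> generate G (pow_conjs s Y J)"
proof (rule conj_by_generate[OF _ _ _ _ x])
  fix a assume "a \<in> pow_conjs s Y I"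
  then obtain j y where "a = conj_by (s [^] j) y" "y \<in> Y" "j \<in> I"
    by (auto simp: pow_conjs_def)
  then have "conj_by (s [^] i) a = conj_by (s [^] (j + i)) y" "y \<in> Y" "j + i \<in> J"
    using s Y J by (auto simp: conj_by_conj_by subset_iff int_pow_mult add.commute)
  then show "conj_by (s [^] i) a \<in> generate G (pow_conjs s Y J)"
    by (auto intro: generate.incl pow_conjsI)
qed (use s Y pow_conjs_closed in auto)

text \<open>A word in the conjugates \<open>s\<^sup>j y s\<^sup>-\<^sup>j\<close> involves only finitely many exponents \<open>j\<close>.
  The normal closure of \<open>Y\<close> in \<open>\<langle>s, Y\<rangle>\<close> is thus the directed union of its windows, the
  subgroups generated by the conjugates with \<open>\<bar>j\<bar> \<le> d\<close>.\<close>
lemma generate_pow_conjs_bounded: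
  assumes x: "x \<in> generate G (pow_conjs s Y UNIV)" and s: "s \<in> carrier G" and Y: "Y \<subseteq> carrier G"
  shows "\<exists>d\<ge>0. x \<in> generate G (pow_conjs s Y {-d..d})"
  using x
proof (induction rule: generate.induct)
  case one
  then show ?case by (auto intro: generate.one)
next
  case (incl h)
  then obtain j :: int and y where "h = conj_by (s [^] j) y" "y \<in> Y" by (blast elim: pow_conjsE)
  then have "h \<in> pow_conjs s Y {-\<bar>j\<bar>..\<bar>j\<bar>}" by (auto intro!: pow_conjsI)
  then show ?case by (intro exI[of _ "\<bar>j\<bar>"]) (auto intro: generate.incl)
next
  case (inv h)
  then obtain j :: int and y where "h = conj_by (s [^] j) y" "y \<in> Y" by (blast elim: pow_conjsE)
  then have "h \<in> pow_conjs s Y {-\<bar>j\<bar>..\<bar>j\<bar>}" by (auto intro!: pow_conjsI)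
  then show ?case by (intro exI[of _ "\<bar>j\<bar>"]) (auto intro: generate.inv)
next
  case (eng x y)
  then obtain d e where "d \<ge> 0" "e \<ge> 0" "x \<in> generate G (pow_conjs s Y {-d..d})"
    "y \<in> generate G (pow_conjs s Y {-e..e})" by auto
  then have "x \<in> generate G (pow_conjs s Y {-max d e..max d e})"
    "y \<in> generate G (pow_conjs s Y {-max d e..max d e})" "max d e \<ge> 0"
    by (auto elim!: generate_pow_conjs_mono[rotated])
  then show ?case by (blast intro: generate.eng)
qed

lemma pow_mult_shift:
  assumes s: "s \<in> carrier G" and m: "m \<in> carrier G"
  shows "(m \<otimes> s) [^] (j + 1 :: int) = (m \<otimes> s) [^] j \<otimes> m \<otimes> s"
    and "(m \<otimes> s) [^] (j - 1 :: int) = (m \<otimes> s) [^] j \<otimes> inv s \<otimes> inv m"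
  using s m by (simp_all add: int_pow_mult int_pow_diff m_assoc inv_mult_group)

text \<open>If conjugation by \<open>g\<close> sends \<open>s\<close> to \<open>m s\<close>, it sends \<open>s\<^sup>j\<close> to
  \<open>(m s)\<^sup>j = m \<cdot> s m s\<^sup>-\<^sup>1 \<cdot> s\<^sup>2 m s\<^sup>-\<^sup>2 \<cdots> s\<^sup>j\<close>. The correction factor in front of \<open>s\<^sup>j\<close> collects
  translates of \<open>m\<close> along the whole way from \<open>0\<close> to \<open>j\<close>, which explains the shape of the window:
  it always contains a neighbourhood of \<open>0\<close>, but beyond the segment from \<open>0\<close> to \<open>j\<close> it extends
  only by a constant.\<close>
lemma twisted_power_window:
  assumes s: "s \<in> carrier G" and Y: "Y \<subseteq> carrier G"
    and m: "m \<in> generate G (pow_conjs s Y {-d..d})" and d: "d \<ge> 0"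
  shows "(m \<otimes> s) [^] (j::int) \<otimes> inv (s [^] j)
    \<in> generate G (pow_conjs s Y {min 0 j - d..max 0 j + d})"
proof -
  note cl = pow_conjs_closed[OF s Y]
  note gcl = generate_closed[OF cl]
  have mc: "m \<in> carrier G" using m generate_in_carrier[OF cl] by blast
  show ?thesis
  proof (induction j rule: int_induct[where k=0])
    case base
    then show ?case by (auto intro: generate.one)
  next
    case (step1 j)
    have "(m \<otimes> s) [^] (j + 1) \<otimes> inv (s [^] (j + 1))
        = (m \<otimes> s) [^] j \<otimes> inv (s [^] j) \<otimes> conj_by (s [^] j) m"
      using s mc by (simp add: pow_mult_shift int_pow_mult conj_by_def m_assoc inv_mult_group)
    moreover have "conj_by (s [^] j) m \<in> generate G (pow_conjs s Y {min 0 (j+1) - d..max 0 (j+1) + d})"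
      using step1 d by (intro generate_pow_conjs_shift[OF s Y m]) auto
    moreover have "(m \<otimes> s) [^] j \<otimes> inv (s [^] j)
      \<in> generate G (pow_conjs s Y {min 0 (j+1) - d..max 0 (j+1) + d})"
      using step1 d by (auto elim!: generate_pow_conjs_mono[rotated])
    ultimately show ?case by (simp add: gcl)
  next
    case (step2 j)
    have "(m \<otimes> s) [^] (j - 1) \<otimes> inv (s [^] (j - 1))
        = (m \<otimes> s) [^] j \<otimes> inv (s [^] j) \<otimes> conj_by (s [^] (j - 1)) (inv m)"
      using s mc by (simp add: pow_mult_shift int_pow_diff conj_by_def m_assoc inv_mult_group)
    moreover have "conj_by (s [^] (j - 1)) (inv m)
        \<in> generate G (pow_conjs s Y {min 0 (j-1) - d..max 0 (j-1) + d})"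
      using step2 d by (intro generate_pow_conjs_shift[OF s Y gcl(2)[OF m]]) auto
    moreover have "(m \<otimes> s) [^] j \<otimes> inv (s [^] j)
      \<in> generate G (pow_conjs s Y {min 0 (j-1) - d..max 0 (j-1) + d})"
      using step2 d by (auto elim!: generate_pow_conjs_mono[rotated])
    ultimately show ?case by (simp add: gcl)
  qed
qed

lemma conj_by_int_pow:
  assumes "g \<in> carrier G" "x \<in> carrier G"
  shows "conj_by g (x [^] (j::int)) = conj_by g x [^] j"
proof -
  have "conj_by g \<in> hom G G" using assms by (auto simp: hom_def conj_by_mult)
  then interpret group_hom G G "conj_by g" by unfold_locales
  show ?thesis using assms by (simp add: hom_int_pow)
qed

text \<open>Conjugation by \<open>g\<close> moves the ends of a window around \<open>0\<close> by at most a constant \<open>d\<close> that does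
  not depend on the window.\<close>
lemma conj_by_window:
  assumes s: "s \<in> carrier G" and Y: "finite Y" "Y \<subseteq> carrier G" and g: "g \<in> carrier G"
    and gs: "conj_by g s \<otimes> inv s \<in> generate G (pow_conjs s Y UNIV)"
    and gY: "\<And>y. y \<in> Y \<Longrightarrow> conj_by g y \<in> generate G (pow_conjs s Y UNIV)"
  shows "\<exists>d\<ge>0. \<forall>y\<in>Y. \<forall>j. conj_by g (conj_by (s [^] (j::int)) y)
    \<in> generate G (pow_conjs s Y {min 0 j - d..max 0 j + d})"
proof -
  note cl = pow_conjs_closed[OF s Y(2)]
  note gcl = generate_closed[OF cl]
  define m where "m = conj_by g s \<otimes> inv s"
  have mc: "m \<in> carrier G" using gs generate_in_carrier[OF cl] by (auto simp: m_def)
  have ms: "conj_by g s = m \<otimes> s" using g s by (simp add: m_def m_assoc)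
  obtain e where e: "e \<ge> 0" "m \<in> generate G (pow_conjs s Y {-e..e})"
    using generate_pow_conjs_bounded[OF gs s Y(2)] by (auto simp: m_def)
  have "\<forall>y\<in>Y. \<exists>d\<ge>0. conj_by g y \<in> generate G (pow_conjs s Y {-d..d})"
    using generate_pow_conjs_bounded[OF gY s Y(2)] by blast
  then obtain D where D: "\<And>y. y \<in> Y \<Longrightarrow> D y \<ge> 0 \<and> conj_by g y \<in> generate G (pow_conjs s Y {-D y..D y})"
    by metis
  define d where "d = Max (insert e (D ` Y))"
  have de: "e \<le> d" and dD: "\<And>y. y \<in> Y \<Longrightarrow> D y \<le> d" using Y(1) by (auto simp: d_def)
  have d0: "d \<ge> 0" using e de by linarith
  have md: "m \<in> generate G (pow_conjs s Y {-d..d})"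
    using e(2) de by (auto elim!: generate_pow_conjs_mono[rotated])
  show ?thesis
  proof (intro exI[of _ d] conjI d0 ballI allI)
    fix y j assume y: "y \<in> Y"
    let ?W = "generate G (pow_conjs s Y {min 0 j - d..max 0 j + d})"
    have yd: "conj_by g y \<in> generate G (pow_conjs s Y {-d..d})"
      using D[OF y] dD[OF y] by (auto elim!: generate_pow_conjs_mono[rotated])
    have yc: "y \<in> carrier G" using y Y by auto
    define w where "w = (m \<otimes> s) [^] j \<otimes> inv (s [^] j)"
    have w: "w \<in> ?W" unfolding w_def by (rule twisted_power_window[OF s Y(2) md d0])
    have wc: "w \<in> carrier G" using s mc by (auto simp: w_def)
    have "conj_by g (conj_by (s [^] j) y) = conj_by (conj_by g (s [^] j)) (conj_by g y)"
      using g s yc by (simp add: conj_by_def inv_mult_group m_assoc)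
    also have "conj_by g (s [^] j) = w \<otimes> s [^] j"
      using g s mc by (simp add: conj_by_int_pow ms w_def m_assoc)
    also have "conj_by (w \<otimes> s [^] j) (conj_by g y) = w \<otimes> conj_by (s [^] j) (conj_by g y) \<otimes> inv w"
      using g s yc wc by (simp flip: conj_by_conj_by) (simp add: conj_by_def)
    also have "\<dots> \<in> ?W"
      using d0 by (intro gcl w generate_pow_conjs_shift[OF s Y(2) yd]) auto
    finally show "conj_by g (conj_by (s [^] j) y) \<in> ?W" .
  qed
qed

text \<open>The mechanism behind all finite generation below. Let \<open>M\<close> be the subgroup generated by all
  conjugates \<open>s\<^sup>j y s\<^sup>-\<^sup>j\<close>, which is usually not finitely generated, and suppose that \<open>t\<close> normalises
  \<open>M\<close> and commutes with \<open>s\<close> modulo \<open>M\<close>. Conjugation by \<open>t\<close> distorts the ends of a window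
  by at most \<open>d\<close>, whereas conjugation by \<open>s\<^sup>-\<^sup>c\<close> translates it by \<open>-c\<close>. As soon as \<open>c > d\<close> the
  translation wins: conjugation by \<open>u = t s\<^sup>-\<^sup>c\<close> maps the conjugates just above a sufficiently wide
  window back into it, and conjugation by \<open>u\<^sup>-\<^sup>1\<close> does the same just below. Starting from one finite
  window, \<open>u\<close> therefore sweeps out all of \<open>M\<close>.\<close>
theorem sweep:
  assumes s: "s \<in> carrier G" and Y: "finite Y" "Y \<subseteq> carrier G" and t: "t \<in> carrier G"
    and ts: "conj_by t s \<otimes> inv s \<in> generate G (pow_conjs s Y UNIV)"
      "conj_by (inv t) s \<otimes> inv s \<in> generate G (pow_conjs s Y UNIV)"
    and tY: "\<And>y. y \<in> Y \<Longrightarrow> conj_by t y \<in> generate G (pow_conjs s Y UNIV)"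
      "\<And>y. y \<in> Y \<Longrightarrow> conj_by (inv t) y \<in> generate G (pow_conjs s Y UNIV)"
  shows "\<exists>D. \<forall>c\<ge>D. \<exists>W. finite W \<and> W \<subseteq> generate G (pow_conjs s Y UNIV) \<and>
    generate G (pow_conjs s Y UNIV) \<subseteq> generate G (insert (t \<otimes> inv (s [^] (c::int))) W)"
proof -
  note cl = pow_conjs_closed[OF s Y(2)]
  obtain d1 where d1: "d1 \<ge> 0" "\<And>y j. y \<in> Y \<Longrightarrow> conj_by t (conj_by (s [^] j) y)
      \<in> generate G (pow_conjs s Y {min 0 j - d1..max 0 j + d1})"
    using conj_by_window[OF s Y t ts(1) tY(1)] by blast
  obtain d2 where d2: "d2 \<ge> 0" "\<And>y j. y \<in> Y \<Longrightarrow> conj_by (inv t) (conj_by (s [^] j) y)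
      \<in> generate G (pow_conjs s Y {min 0 j - d2..max 0 j + d2})"
    using conj_by_window[OF s Y inv_closed[OF t] ts(2) tY(2)] by blast
  define d where "d = max d1 d2"
  have d: "d \<ge> 0" "d1 \<le> d" "d2 \<le> d" using d1 by (auto simp: d_def)
  show ?thesis
  proof (intro exI[of _ "d + 1"] allI impI)
    fix c assume c: "c \<ge> d + 1"
    define u where "u = t \<otimes> inv (s [^] c)"
    have uc: "u \<in> carrier G" using t s by (simp add: u_def)
    have iu: "inv u = s [^] c \<otimes> inv t" using t s by (simp add: u_def inv_mult_group)
    \<comment> \<open>Images of the ends reach back to \<open>0\<close> up to an error \<open>d\<close>, and under conjugation by \<open>u\<^sup>-\<^sup>1\<close> they
      are shifted by \<open>c\<close> afterwards. These parts do not move along with the ends, so the initial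
      window has to contain them.\<close>
    define W where "W = pow_conjs s Y {-d-c..d+c}"
    have WC: "insert u W \<subseteq> carrier G" using uc cl by (auto simp: W_def)
    let ?H = "generate G (insert u W)"
    note Hcl = generate_closed[OF WC]
    have uH: "u \<in> ?H" by (auto intro: generate.incl)
    have conjH: "x \<in> ?H" if "x \<in> carrier G" "conj_by u x \<in> ?H" for x
    proof -
      have "x = inv u \<otimes> conj_by u x \<otimes> u" using that uc by (simp add: conj_by_def m_assoc)
      then show ?thesis using that Hcl uH by metis
    qed
    have conjH': "x \<in> ?H" if "x \<in> carrier G" "conj_by (inv u) x \<in> ?H" for x
    proof -
      have "x = u \<otimes> conj_by (inv u) x \<otimes> inv u" using that uc by (simp add: conj_by_def m_assoc)
      then show ?thesis using that Hcl uH by metis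
    qed
    have step: "pow_conjs s Y {-d-c-int n..d+c+int n} \<subseteq> ?H" for n
    proof (induction n)
      case 0
      show ?case by (auto simp: W_def intro: generate.incl)
    next
      case (Suc n)
      then have sub: "generate G (pow_conjs s Y {-d-c-int n..d+c+int n}) \<subseteq> ?H"
        by (intro generate_subgroup_incl generate_is_subgroup WC)
      show ?case
      proof
        fix x assume "x \<in> pow_conjs s Y {-d-c-int (Suc n)..d+c+int (Suc n)}"
        then obtain j y where x: "x = conj_by (s [^] j) y" and y: "y \<in> Y"
          and j: "j \<in> {-d-c-int n..d+c+int n} \<or> j = d+c+int n+1 \<or> j = -d-c-int n-1"
          by (force simp: pow_conjs_def)
        have yc: "y \<in> carrier G" and xc: "x \<in> carrier G" using y Y s x by auto
        consider "j \<in> {-d-c-int n..d+c+int n}" | "j = d+c+int n+1" | "j = -d-c-int n-1"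
          using j by blast
        then show "x \<in> ?H"
        proof cases
          case 1
          then have "x \<in> pow_conjs s Y {-d-c-int n..d+c+int n}" using y x by (auto intro: pow_conjsI)
          then show ?thesis using Suc by blast
        next
          case 2
          have "conj_by u x = conj_by t (conj_by (s [^] (j - c)) y)"
            using t s yc int_pow_mult[OF s, of "-c" j]
            by (simp add: x u_def int_pow_neg conj_by_conj_by m_assoc)
          also have "\<dots> \<in> generate G (pow_conjs s Y {-d-c-int n..d+c+int n})"
            by (rule generate_pow_conjs_mono[OF _ d1(2)[OF y]]) (use 2 c d in auto)
          finally show ?thesis using conjH xc sub by blast
        next
          case 3
          have "conj_by (inv u) x = conj_by (s [^] c) (conj_by (inv t) (conj_by (s [^] j) y))"
            using t s yc by (simp add: x iu conj_by_conj_by m_assoc)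
          also have "\<dots> \<in> generate G (pow_conjs s Y {-d-c-int n..d+c+int n})"
            by (rule generate_pow_conjs_shift[OF s Y(2) d2(2)[OF y]]) (use 3 c d in auto)
          finally show ?thesis using conjH' xc sub by blast
        qed
      qed
    qed
    have "pow_conjs s Y UNIV \<subseteq> ?H"
    proof
      fix x assume "x \<in> pow_conjs s Y UNIV"
      then obtain j :: int and y where "x = conj_by (s [^] j) y" "y \<in> Y" by (blast elim: pow_conjsE)
      then have "x \<in> pow_conjs s Y {-d-c-int (nat \<bar>j\<bar>)..d+c+int (nat \<bar>j\<bar>)}"
        using c d by (auto intro!: pow_conjsI)
      then show "x \<in> ?H" using step by blast
    qed
    then have "generate G (pow_conjs s Y UNIV) \<subseteq> ?H"
      by (intro generate_subgroup_incl generate_is_subgroup WC)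
    moreover have "finite W" using Y(1) by (auto simp: W_def pow_conjs_def)
    moreover have "W \<subseteq> generate G (pow_conjs s Y UNIV)"
      using pow_conjs_mono[of _ UNIV s Y] by (auto simp: W_def intro: generate.incl)
    ultimately show "\<exists>W. finite W \<and> W \<subseteq> generate G (pow_conjs s Y UNIV) \<and>
        generate G (pow_conjs s Y UNIV) \<subseteq> generate G (insert (t \<otimes> inv (s [^] c)) W)"
      unfolding u_def by blast
  qed
qed

section \<open>Kernels of integer-valued characters\<close>

lemma finitely_generated_subgroup_iff:
  assumes "subgroup H G"
  shows "finitely_generated (G\<lparr>carrier := H\<rparr>) \<longleftrightarrow> (\<exists>S. finite S \<and> S \<subseteq> H \<and> generate G S = H)"
  using generate_consistent[OF _ assms] by (auto simp: finitely_generated_def)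

lemma hom_integer_group:
  assumes "\<psi> \<in> hom G integer_group"
  shows "x \<in> carrier G \<Longrightarrow> y \<in> carrier G \<Longrightarrow> \<psi> (x \<otimes> y) = \<psi> x + \<psi> y"
    "x \<in> carrier G \<Longrightarrow> \<psi> (inv x) = - \<psi> x" "\<psi> \<one> = 0"
    "x \<in> carrier G \<Longrightarrow> \<psi> (x [^] (j::int)) = j * \<psi> x"
proof -
  interpret group_hom G integer_group \<psi>
    using assms by (simp add: group_hom_def group_hom_axioms_def is_group)
  show "x \<in> carrier G \<Longrightarrow> y \<in> carrier G \<Longrightarrow> \<psi> (x \<otimes> y) = \<psi> x + \<psi> y"
    "x \<in> carrier G \<Longrightarrow> \<psi> (inv x) = - \<psi> x" "\<psi> \<one> = 0" by simp_all
  show "x \<in> carrier G \<Longrightarrow> \<psi> (x [^] (j::int)) = j * \<psi> x" by (simp add: hom_int_pow)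
qed

lemma conj_by_int_pow_closed:
  assumes H: "H \<subseteq> carrier G" and s: "s \<in> carrier G"
    and "\<And>x. x \<in> H \<Longrightarrow> conj_by s x \<in> H" "\<And>x. x \<in> H \<Longrightarrow> conj_by (inv s) x \<in> H"
    and x: "x \<in> H"
  shows "conj_by (s [^] (j::int)) x \<in> H"
proof (induction j rule: int_induct[where k=0])
  case base
  then show ?case using x H by (auto simp: subset_iff)
next
  case (step1 j)
  have "conj_by (s [^] (j + 1)) x = conj_by s (conj_by (s [^] j) x)"
    using s x H int_pow_mult[OF s, of 1 j] by (simp add: conj_by_conj_by subset_iff add.commute)
  then show ?case using step1 assms by simp
next
  case (step2 j)
  have "conj_by (s [^] (j - 1)) x = conj_by (inv s) (conj_by (s [^] j) x)"
    using s x H int_pow_mult[OF s, of "-1" j]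
    by (simp add: conj_by_conj_by subset_iff add.commute int_pow_neg)
  then show ?case using step2 assms by simp
qed

text \<open>Modulo \<open>M\<close> the element \<open>s\<close> commutes with all of \<open>T\<close>, so the subgroup generated by \<open>M\<close> and
  the corrected generators \<open>t s\<^sup>-\<^sup>\<psi>\<^sup>t\<close> is normalised by \<open>s\<close>, and together with the powers of \<open>s\<close> it
  exhausts the group.\<close>
lemma kernel_generators:
  assumes \<psi>: "\<psi> \<in> hom G integer_group"
    and M: "subgroup M G" "\<And>x. x \<in> M \<Longrightarrow> \<psi> x = 0"
    and s: "s \<in> carrier G" "\<psi> s = 1"
    and sM: "\<And>x. x \<in> M \<Longrightarrow> conj_by s x \<in> M" "\<And>x. x \<in> M \<Longrightarrow> conj_by (inv s) x \<in> M"
    and T: "T \<subseteq> carrier G" "\<And>t. t \<in> T \<Longrightarrow> conj_by s t \<otimes> inv t \<in> M"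
    and x: "x \<in> generate G (insert s (M \<union> T))" "\<psi> x = 0"
  shows "x \<in> generate G (M \<union> (\<lambda>t. t \<otimes> inv (s [^] \<psi> t)) ` T)"
proof -
  define u where "u t = t \<otimes> inv (s [^] \<psi> t)" for t
  let ?H = "generate G (M \<union> u ` T)"
  note \<psi>h = hom_integer_group[OF \<psi>]
  have Mc: "M \<subseteq> carrier G" using M by (simp add: subgroup.subset)
  have uc: "u t \<in> carrier G" if "t \<in> T" for t using that T s by (auto simp: u_def)
  have gc: "M \<union> u ` T \<subseteq> carrier G" using Mc uc by auto
  note Hcl = generate_closed[OF gc]
  have Hc: "?H \<subseteq> carrier G" using generate_incl[OF gc] .
  have MH: "m \<in> ?H" if "m \<in> M" for m using that by (auto intro: generate.incl)
  have uH: "u t \<in> ?H" if "t \<in> T" for t using that by (auto intro: generate.incl)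
  have sH: "conj_by s h \<in> ?H" if "h \<in> ?H" for h
  proof (rule conj_by_generate[OF gc gc s(1) _ that])
    fix a assume "a \<in> M \<union> u ` T"
    then show "conj_by s a \<in> ?H"
    proof
      assume "a \<in> u ` T"
      then obtain t where t: "a = u t" "t \<in> T" by auto
      have tc: "t \<in> carrier G" using t T by auto
      have comm: "s \<otimes> inv (s [^] \<psi> t) = inv (s [^] \<psi> t) \<otimes> s"
        using s int_pow_mult[OF s(1), of 1 "- \<psi> t"] int_pow_mult[OF s(1), of "- \<psi> t" 1]
        by (simp add: int_pow_neg)
      have "conj_by s a = conj_by s t \<otimes> (s \<otimes> inv (s [^] \<psi> t)) \<otimes> inv s"
        using s tc by (simp add: t u_def conj_by_def m_assoc)
      also have "\<dots> = (conj_by s t \<otimes> inv t) \<otimes> u t"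
        using s tc unfolding comm by (simp add: u_def m_assoc)
      finally show ?thesis using t T MH uH Hcl by simp
    qed (use sM MH in auto)
  qed
  have siH: "conj_by (inv s) h \<in> ?H" if "h \<in> ?H" for h
  proof (rule conj_by_generate[OF gc gc inv_closed[OF s(1)] _ that])
    fix a assume "a \<in> M \<union> u ` T"
    then show "conj_by (inv s) a \<in> ?H"
    proof
      assume "a \<in> u ` T"
      then obtain t where t: "a = u t" "t \<in> T" by auto
      have tc: "t \<in> carrier G" using t T by auto
      have comm: "s \<otimes> inv (s [^] \<psi> t) = inv (s [^] \<psi> t) \<otimes> s"
        using s int_pow_mult[OF s(1), of 1 "- \<psi> t"] int_pow_mult[OF s(1), of "- \<psi> t" 1]
        by (simp add: int_pow_neg)
      have "conj_by (inv s) a = inv s \<otimes> t \<otimes> (inv (s [^] \<psi> t) \<otimes> s)"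
        using s tc by (simp add: t u_def conj_by_def m_assoc)
      also have "\<dots> = inv (conj_by (inv s) (conj_by s t \<otimes> inv t)) \<otimes> u t"
        using s tc unfolding comm[symmetric] by (simp add: u_def conj_by_def m_assoc inv_mult_group)
      finally show ?thesis using t T MH uH Hcl sM by simp
    qed (use sM MH in auto)
  qed
  note sjH = conj_by_int_pow_closed[OF Hc s(1) sH siH]
  have ic: "insert s (M \<union> T) \<subseteq> carrier G" using s Mc T by auto
  \<comment> \<open>Modulo \<open>?H\<close>, every element is a power of \<open>s\<close>, the exponent being the value of \<open>\<psi>\<close>.\<close>
  have *: "g \<otimes> inv (s [^] \<psi> g) \<in> ?H" if "g \<in> insert s (M \<union> T)" for g
    using that s M(2) MH uH Mc by (auto simp: u_def generate.one \<psi>h)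
  have "g \<otimes> inv (s [^] \<psi> g) \<in> ?H" if "g \<in> generate G (insert s (M \<union> T))" for g
    using that
  proof (induction rule: generate.induct)
    case one
    then show ?case by (simp add: \<psi>h generate.one)
  next
    case (incl g)
    then show ?case by (rule *)
  next
    case (inv g)
    then have g: "g \<in> carrier G" using ic by auto
    have "inv g \<otimes> inv (s [^] \<psi> (inv g)) = conj_by (s [^] (- \<psi> g)) (inv (g \<otimes> inv (s [^] \<psi> g)))"
      using g s by (simp add: \<psi>h conj_by_def inv_mult_group int_pow_neg m_assoc)
    then show ?case using sjH Hcl(2) *[OF inv] by simp
  next
    case (eng g h)
    have gh: "g \<in> carrier G" "h \<in> carrier G" using eng generate_in_carrier[OF ic] by auto
    have "g \<otimes> h \<otimes> inv (s [^] \<psi> (g \<otimes> h)) =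
      (g \<otimes> inv (s [^] \<psi> g)) \<otimes> conj_by (s [^] \<psi> g) (h \<otimes> inv (s [^] \<psi> h))"
      using gh s by (simp add: \<psi>h conj_by_def inv_mult_group m_assoc int_pow_mult)
    then show ?case using eng sjH Hcl(1) by simp
  qed
  from this[OF x(1)] x(2) show ?thesis
    using generate_in_carrier[OF ic x(1)] by (simp add: u_def)
qed

section \<open>Subgroups of finite index\<close>

text \<open>Schreier's lemma. For a choice of coset representatives, the elements
  \<open>rep g \<cdot> x \<cdot> (rep (g x))\<^sup>-\<^sup>1\<close> multiply like a cocycle in \<open>x\<close>, so those with \<open>x\<close> in the generating
  set generate all of them. For \<open>g = \<one>\<close> and \<open>x \<in> H\<close> the element is \<open>x\<close> itself, because \<open>H\<close> is
  represented by \<open>\<one>\<close>.\<close>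
theorem finite_index_generators:
  assumes S: "finite S" "S \<subseteq> carrier G" "generate G S = carrier G"
    and H: "subgroup H G" "finite (rcosets H)"
  shows "\<exists>T. finite T \<and> T \<subseteq> H \<and> generate G T = H"
proof -
  define rep where "rep x = (if x \<in> H then \<one> else SOME y. y \<in> H #> x)" for x
  have Hc: "H \<subseteq> carrier G" using H by (simp add: subgroup.subset)
  have rep: "rep x \<in> H #> x" if "x \<in> carrier G" for x
  proof (cases "x \<in> H")
    case True
    then show ?thesis using H that by (simp add: rep_def coset_join2 subgroup.one_closed)
  next
    case False
    then show ?thesis using rcos_self[OF that H(1)] by (simp add: rep_def) (rule someI)
  qed
  have repc: "rep x \<in> carrier G" if "x \<in> carrier G" for x
    using rep[OF that] r_coset_subset_G[OF Hc that] by blast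
  have coset_rep: "H #> rep x = H #> x" if "x \<in> carrier G" for x
    using repr_independence[OF rep[OF that] that H(1)] by simp
  have rep_cong: "rep x = rep y" if "H #> x = H #> y" "x \<in> carrier G" "y \<in> carrier G" for x y
    using that rcos_self[OF _ H(1)] coset_join2[OF _ H(1)] coset_join1[OF _ _ H(1)]
    by (metis rep_def)
  have rep_rep: "rep (rep x \<otimes> y) = rep (x \<otimes> y)" if "x \<in> carrier G" "y \<in> carrier G" for x y
    using that by (intro rep_cong) (simp_all add: repc coset_rep Hc flip: coset_mult_assoc)
  have "rep ` carrier G \<subseteq> (\<lambda>c. if c = H then \<one> else SOME y. y \<in> c) ` (rcosets H)"
  proof
    fix z assume "z \<in> rep ` carrier G"
    then obtain x where x: "x \<in> carrier G" "z = rep x" by auto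
    then show "z \<in> (\<lambda>c. if c = H then \<one> else SOME y. y \<in> c) ` (rcosets H)"
      using coset_join2[OF _ H(1), of x] coset_join1[OF _ _ H(1), of x] rcosetsI[OF Hc x(1)]
      by (intro image_eqI[of _ _ "H #> x"]) (auto simp: rep_def)
  qed
  then have fin: "finite (rep ` carrier G)" using H(2) finite_surj by blast
  define e where "e g x = rep g \<otimes> x \<otimes> inv (rep (g \<otimes> x))" for g x
  have e_cong: "e g x = e (rep g) x" if "g \<in> carrier G" "x \<in> carrier G" for g x
    using that rep_rep[of g x] rep_cong[OF coset_rep[OF that(1)]] repc by (simp add: e_def)
  define T where "T = (\<lambda>(g, x). e g x) ` (carrier G \<times> S)"
  have "T \<subseteq> (\<lambda>(g, x). e g x) ` (rep ` carrier G \<times> S)"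
    using e_cong S(2) by (force simp: T_def image_iff)
  then have "finite T" by (rule finite_subset) (use fin S(1) in auto)
  have eH: "e g x \<in> H" if "g \<in> carrier G" "x \<in> carrier G" for g x
  proof -
    have "H #> (rep g \<otimes> x) = H #> rep (g \<otimes> x)"
      using that by (simp add: repc coset_rep Hc flip: coset_mult_assoc)
    then have "H #> e g x = H"
      using that by (simp add: e_def repc coset_mult_inv2 Hc)
    then show ?thesis using that repc by (intro coset_join1[OF _ _ H(1)]) (auto simp: e_def)
  qed
  have TH: "T \<subseteq> H" using eH S(2) by (auto simp: T_def)
  have Tc: "T \<subseteq> carrier G" using TH Hc by auto
  note Tcl = generate_closed[OF Tc]
  have "\<forall>g\<in>carrier G. e g x \<in> generate G T" if "x \<in> generate G S" for x
    using that
  proof (induction rule: generate.induct)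
    case one
    then show ?case by (auto simp: e_def repc generate.one)
  next
    case (incl x)
    then show ?case by (auto simp: T_def intro!: generate.incl)
  next
    case (inv x)
    then have x: "x \<in> carrier G" using S by auto
    show ?case
    proof
      fix g assume g: "g \<in> carrier G"
      have "e g (inv x) = inv (e (g \<otimes> inv x) x)"
        using g x by (simp add: e_def repc inv_mult_group m_assoc)
      moreover have "e (g \<otimes> inv x) x \<in> T" using g x inv by (auto simp: T_def)
      ultimately show "e g (inv x) \<in> generate G T" by (auto intro: generate.inv)
    qed
  next
    case (eng x y)
    have xy: "x \<in> carrier G" "y \<in> carrier G" using eng S by auto
    show ?case
    proof
      fix g assume g: "g \<in> carrier G"
      have "e g (x \<otimes> y) = e g x \<otimes> e (g \<otimes> x) y"
        using g xy by (simp add: e_def repc inv_mult_group m_assoc)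
      then show "e g (x \<otimes> y) \<in> generate G T" using eng g xy Tcl by simp
    qed
  qed
  then have "e \<one> x \<in> generate G T" if "x \<in> carrier G" for x
    using that S(3) by auto
  moreover have "e \<one> x = x" if "x \<in> H" for x
    using that Hc subgroup.one_closed[OF H(1)] by (auto simp: e_def rep_def subset_iff)
  ultimately have "x \<in> generate G T" if "x \<in> H" for x
    using that Hc by (metis subsetD)
  moreover have "generate G T \<subseteq> H" using generate_subgroup_incl[OF TH H(1)] .
  ultimately show ?thesis using \<open>finite T\<close> TH by blast
qed

lemma finite_rcosets_if:
  assumes H: "subgroup H G" and fin: "finite (v ` carrier G)"
    and v: "\<And>x y. x \<in> carrier G \<Longrightarrow> y \<in> carrier G \<Longrightarrow> v x = v y \<Longrightarrow> x \<otimes> inv y \<in> H"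
  shows "finite (rcosets H)"
proof -
  have eq: "H #> x = H #> y" if "x \<in> carrier G" "y \<in> carrier G" "v x = v y" for x y
    using v[OF that] that H coset_join2[OF _ H, of "x \<otimes> inv y"] coset_mult_inv1[of H x y]
    by (auto simp: subgroup.subset)
  have "rcosets H \<subseteq> (\<lambda>z. H #> inv_into (carrier G) v z) ` (v ` carrier G)"
  proof
    fix c assume "c \<in> rcosets H"
    then obtain x where x: "x \<in> carrier G" "c = H #> x" by (auto simp: RCOSETS_def)
    have "c = H #> inv_into (carrier G) v (v x)"
      unfolding x(2) using x(1) by (intro eq) (auto simp: f_inv_into_f inv_into_into)
    then show "c \<in> (\<lambda>z. H #> inv_into (carrier G) v z) ` (v ` carrier G)" using x(1) by blast
  qed
  then show ?thesis by (rule finite_subset) (use fin in auto)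
qed

lemma finite_index_power:
  assumes H: "subgroup H G" "finite (rcosets H)" and x: "x \<in> carrier G"
  shows "\<exists>k>0. x [^] (k::nat) \<in> H"
proof -
  have Hc: "H \<subseteq> carrier G" using H by (simp add: subgroup.subset)
  have "\<not> inj (\<lambda>k::nat. H #> (x [^] k))"
  proof
    assume "inj (\<lambda>k::nat. H #> (x [^] k))"
    then have "infinite (range (\<lambda>k::nat. H #> (x [^] k)))" using range_inj_infinite by blast
    moreover have "range (\<lambda>k::nat. H #> (x [^] k)) \<subseteq> rcosets H" using x rcosetsI[OF Hc] by auto
    ultimately show False using H(2) finite_subset by blast
  qed
  then obtain i j :: nat where ij: "i < j" "H #> (x [^] i) = H #> (x [^] j)"
    by (auto simp: inj_def) (metis linorder_neqE_nat)
  have "x [^] j \<otimes> inv (x [^] i) = x [^] (j - i)"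
    using ij x nat_pow_mult[OF x, of "j - i" i] by (metis inv_solve_right le_add_diff_inverse2 less_imp_le nat_pow_closed)
  moreover have "x [^] j \<otimes> inv (x [^] i) \<in> H"
    using coset_mult_inv2[OF ij(2)[symmetric]] x H Hc coset_join1[OF _ _ H(1)] by simp
  ultimately show ?thesis using ij by (intro exI[of _ "j - i"]) auto
qed

section \<open>Sweeping inside a normal subgroup\<close>

text \<open>Correcting generators of \<open>L\<close> by powers of \<open>s\<close> gives \<open>L = \<langle>s, Y\<rangle>\<close> with \<open>Y\<close> in the kernel of
  \<open>F\<close>. Then \<open>L \<inter> ker F\<close> is generated by the conjugates of \<open>Y\<close> under powers of \<open>s\<close>. Since \<open>F\<close> is
  defined on the whole group, \<open>t\<close> commutes with \<open>s\<close> modulo this subgroup.\<close>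
theorem sweep_kernel:
  assumes L: "L \<lhd> G" "finite S" "generate G S = L" "S \<subseteq> carrier G"
    and F: "F \<in> hom G integer_group" and s: "s \<in> L" "F s = 1" and t: "t \<in> carrier G"
  shows "\<exists>D. \<forall>c\<ge>D. \<exists>W. finite W \<and> W \<subseteq> {x \<in> L. F x = 0} \<and>
    {x \<in> L. F x = 0} \<subseteq> generate G (insert (t \<otimes> inv (s [^] (c::int))) W)"
proof -
  interpret L: normal L G by fact
  note Fh = hom_integer_group[OF F]
  have sc: "s \<in> carrier G" using s L.subset by auto
  define Y where "Y = (\<lambda>y. y \<otimes> inv (s [^] F y)) ` S"
  have Yc: "Y \<subseteq> carrier G" using L(4) sc by (auto simp: Y_def)
  have SL: "S \<subseteq> L" using L(3) by (auto intro: generate.incl)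
  let ?M = "generate G (pow_conjs s Y UNIV)"
  note cl = pow_conjs_closed[OF sc Yc]
  have sj: "s [^] (j::int) \<in> L" for j
    using s(1) by (simp add: subgroup_int_pow_closed L.subgroup_axioms)
  have YL: "Y \<subseteq> {x \<in> L. F x = 0}"
    using SL sj sc L(4) s(2) by (auto simp: Y_def Fh subset_iff)
  have sub: "subgroup {x \<in> L. F x = 0} G"
  proof
    show "{x \<in> L. F x = 0} \<subseteq> carrier G" by (auto intro: L.mem_carrier)
  qed (auto simp: Fh L.mem_carrier)
  have "pow_conjs s Y UNIV \<subseteq> {x \<in> L. F x = 0}"
    using YL sj sc by (auto elim!: pow_conjsE simp: conj_by_def Fh L.mem_carrier subset_iff)
  then have M1: "?M \<subseteq> {x \<in> L. F x = 0}" using generate_subgroup_incl[OF _ sub] by blast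
  have M2: "{x \<in> L. F x = 0} \<subseteq> ?M"
  proof
    fix x assume x: "x \<in> {x \<in> L. F x = 0}"
    have ic: "insert s (?M \<union> {}) \<subseteq> carrier G" using sc generate_incl[OF cl] by auto
    have "y \<in> generate G (insert s (?M \<union> {}))" if "y \<in> S" for y
    proof -
      have "y \<otimes> inv (s [^] F y) \<in> pow_conjs s Y UNIV"
        using that Yc pow_conjsI[of 0 UNIV "y \<otimes> inv (s [^] F y)" Y s] sc L(4) by (auto simp: Y_def)
      then have 1: "y \<otimes> inv (s [^] F y) \<in> generate G (insert s (?M \<union> {}))"
        by (intro generate.incl) (auto intro: generate.incl)
      have "s [^] F y \<in> generate G (insert s (?M \<union> {}))"
        by (intro subgroup_int_pow_closed generate_is_subgroup ic) (auto intro: generate.incl)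
      from generate.eng[OF 1 this] show ?thesis using that L(4) sc by (auto simp: m_assoc subset_iff)
    qed
    then have "L \<subseteq> generate G (insert s (?M \<union> {}))"
      unfolding L(3)[symmetric] by (intro generate_subgroup_incl generate_is_subgroup ic) auto
    then have xi: "x \<in> generate G (insert s (?M \<union> {}))" using x by auto
    have "x \<in> generate G (?M \<union> (\<lambda>t. t \<otimes> inv (s [^] F t)) ` {})"
    proof (rule kernel_generators[OF F _ _ sc s(2) _ _ _ _ xi])
      show "conj_by s z \<in> ?M" if "z \<in> ?M" for z
        using generate_pow_conjs_shift[OF sc Yc that, of 1 UNIV] sc by simp
      show "conj_by (inv s) z \<in> ?M" if "z \<in> ?M" for z
        using generate_pow_conjs_shift[OF sc Yc that, of "-1" UNIV] sc by (simp add: int_pow_neg)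
    qed (use x M1 generate_is_subgroup[OF cl] in auto)
    then show "x \<in> ?M"
      using generate_subgroup_incl[OF subset_refl generate_is_subgroup[OF cl]] by auto
  qed
  have M: "?M = {x \<in> L. F x = 0}" using M1 M2 by auto
  have tL: "conj_by g x \<in> L" if "g \<in> carrier G" "x \<in> L" for g x
    using that L.inv_op_closed2 by (simp add: conj_by_def)
  have tF: "F (conj_by g x) = F x" if "g \<in> carrier G" "x \<in> L" for g x
    using that by (simp add: conj_by_def Fh L.mem_carrier)
  have YL': "y \<in> L" "F y = 0" "y \<in> carrier G" if "y \<in> Y" for y
    using that YL Yc by auto
  have finY: "finite Y" using L(2) by (simp add: Y_def)
  show ?thesis unfolding M[symmetric]
  proof (rule sweep[OF sc finY Yc t])
    fix y assume "y \<in> Y"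
    then show "conj_by t y \<in> ?M" "conj_by (inv t) y \<in> ?M"
      unfolding M using t YL' by (simp_all add: tL tF)
  qed (use t s sc in \<open>auto simp: M tL tF Fh\<close>)
qed

lemma hom_add_integer_group:
  assumes "F \<in> hom G integer_group" "\<tau> \<in> hom G integer_group"
  shows "(\<lambda>x. F x + c * \<tau> x) \<in> hom G integer_group"
  using assms by (auto simp: hom_def algebra_simps)

text \<open>For the character \<open>F + c \<tau>\<close> with \<open>c\<close> large, the element \<open>t s\<^sup>-\<^sup>k\<close> that is needed to sweep out
  \<open>L \<inter> ker F\<close> may be taken in the kernel of that character.\<close>
lemma sweep_kernel_large:
  assumes L: "L \<lhd> G" "finite S" "generate G S = L" "S \<subseteq> carrier G"
    and F: "F \<in> hom G integer_group" and s: "s \<in> L" "F s = 1"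
    and t: "t \<in> carrier G" "\<tau> t > (0::int)"
  shows "\<exists>D. \<forall>c\<ge>D. \<exists>W. finite W \<and> W \<subseteq> {x \<in> L. F x = 0} \<and>
    {x \<in> L. F x = 0} \<subseteq> generate G (insert (t \<otimes> inv (s [^] (F t + c * \<tau> t))) W)"
proof -
  obtain D where D: "\<And>c. c \<ge> D \<Longrightarrow> \<exists>W. finite W \<and> W \<subseteq> {x \<in> L. F x = 0} \<and>
    {x \<in> L. F x = 0} \<subseteq> generate G (insert (t \<otimes> inv (s [^] (c::int))) W)"
    using sweep_kernel[OF L F s t(1)] by blast
  show ?thesis
  proof (intro exI[of _ "\<bar>D\<bar> + \<bar>F t\<bar>"] allI impI)
    fix c assume c: "c \<ge> \<bar>D\<bar> + \<bar>F t\<bar>"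
    have "c * 1 \<le> c * \<tau> t" using c t(2) by (intro mult_left_mono) auto
    then show "\<exists>W. finite W \<and> W \<subseteq> {x \<in> L. F x = 0} \<and>
      {x \<in> L. F x = 0} \<subseteq> generate G (insert (t \<otimes> inv (s [^] (F t + c * \<tau> t))) W)"
      using c by (intro D) linarith
  qed
qed

lemma kernel_finite_generators:
  assumes L: "L \<lhd> G"
    and \<psi>: "\<psi> \<in> hom G integer_group" and s: "s \<in> L" "\<psi> s = 1"
    and T: "finite T" "T \<subseteq> carrier G" "generate G (L \<union> T) = carrier G" "t \<in> T"
    and W: "finite W" "W \<subseteq> {x \<in> L. \<psi> x = 0}"
      "{x \<in> L. \<psi> x = 0} \<subseteq> generate G (insert (t \<otimes> inv (s [^] \<psi> t)) W)"
  shows "finitely_generated (G\<lparr>carrier := kernel G integer_group \<psi>\<rparr>)"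
proof -
  interpret L: normal L G by fact
  note \<psi>h = hom_integer_group[OF \<psi>]
  define u where "u t = t \<otimes> inv (s [^] \<psi> t)" for t
  define K where "K = kernel G integer_group \<psi>"
  let ?M = "{x \<in> L. \<psi> x = 0}"
  have sc: "s \<in> carrier G" using s L.subset by auto
  have K: "subgroup K G"
    unfolding K_def using \<psi> by (intro group_hom.subgroup_kernel)
      (simp add: group_hom_def group_hom_axioms_def is_group)
  have sub: "subgroup ?M G"
  proof
    show "{x \<in> L. \<psi> x = 0} \<subseteq> carrier G" by (auto intro: L.mem_carrier)
  qed (auto simp: \<psi>h L.mem_carrier)
  have uK: "u x \<in> K" if "x \<in> T" for x
    using that T sc s(2) by (auto simp: u_def K_def kernel_def \<psi>h subset_iff)
  have MK: "?M \<subseteq> K" by (auto simp: K_def kernel_def L.mem_carrier)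
  let ?A = "W \<union> u ` T"
  have AK: "?A \<subseteq> K" using W(2) MK uK by auto
  then have Ac: "?A \<subseteq> carrier G" using K by (auto simp: subgroup.mem_carrier)
  have "K \<subseteq> generate G ?A"
  proof
    fix x assume x: "x \<in> K"
    have ic: "insert s (?M \<union> T) \<subseteq> carrier G" using sc T L.mem_carrier by auto
    have "y \<in> generate G (insert s (?M \<union> T))" if "y \<in> L" for y
    proof -
      have yc: "y \<in> carrier G" using that L.mem_carrier by auto
      have "s [^] \<psi> y \<in> L" using s(1) by (simp add: subgroup_int_pow_closed L.subgroup_axioms)
      then have "y \<otimes> inv (s [^] \<psi> y) \<in> ?M" using that yc sc s(2) by (auto simp: \<psi>h)
      then have 1: "y \<otimes> inv (s [^] \<psi> y) \<in> generate G (insert s (?M \<union> T))"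
        by (intro generate.incl) auto
      have "s [^] \<psi> y \<in> generate G (insert s (?M \<union> T))"
        by (intro subgroup_int_pow_closed generate_is_subgroup ic) (auto intro: generate.incl)
      from generate.eng[OF 1 this] show ?thesis using yc sc by (auto simp: m_assoc)
    qed
    then have "L \<union> T \<subseteq> generate G (insert s (?M \<union> T))" by (auto intro: generate.incl)
    then have "carrier G \<subseteq> generate G (insert s (?M \<union> T))"
      unfolding T(3)[symmetric] by (intro generate_subgroup_incl generate_is_subgroup ic)
    then have xi: "x \<in> generate G (insert s (?M \<union> T))" using x K by (auto simp: subgroup.mem_carrier)
    have "x \<in> generate G (?M \<union> (\<lambda>t. t \<otimes> inv (s [^] \<psi> t)) ` T)"
    proof (rule kernel_generators[OF \<psi> sub _ sc s(2) _ _ T(2) _ xi])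
      show "conj_by s z \<in> ?M" if "z \<in> ?M" for z
        using that s by (auto simp: conj_by_def \<psi>h L.mem_carrier)
      show "conj_by (inv s) z \<in> ?M" if "z \<in> ?M" for z
        using that s by (auto simp: conj_by_def \<psi>h L.mem_carrier)
      show "conj_by s z \<otimes> inv z \<in> ?M" if "z \<in> T" for z
      proof -
        have zc: "z \<in> carrier G" using that T by auto
        have "conj_by s z \<otimes> inv z = s \<otimes> (z \<otimes> inv s \<otimes> inv z)"
          using zc sc by (simp add: conj_by_def m_assoc)
        moreover have "z \<otimes> inv s \<otimes> inv z \<in> L" using L.inv_op_closed2[OF zc] s(1) by simp
        moreover have "\<psi> (conj_by s z \<otimes> inv z) = 0" using zc sc by (simp add: conj_by_def \<psi>h)
        ultimately show ?thesis using s(1) by auto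
      qed
    qed (use x in \<open>auto simp: K_def kernel_def\<close>)
    moreover have "generate G (?M \<union> u ` T) \<subseteq> generate G ?A"
    proof (intro generate_subgroup_incl generate_is_subgroup Ac)
      have "generate G (insert (u t) W) \<subseteq> generate G ?A"
        using T(4) by (intro mono_generate) auto
      then show "?M \<union> u ` T \<subseteq> generate G ?A" using W(3) by (auto simp: u_def intro: generate.incl)
    qed
    ultimately show "x \<in> generate G ?A" by (auto simp: u_def)
  qed
  moreover have "generate G ?A \<subseteq> K" using generate_subgroup_incl[OF AK K] .
  ultimately have "generate G ?A = K" by auto
  moreover have "finite ?A" using T(1) W(1) by auto
  ultimately show ?thesis
    unfolding K_def[symmetric] finitely_generated_subgroup_iff[OF K] using AK by blast
qed

section \<open>Limits of homomorphisms from finitely presented groups\<close>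

lemma homs_eq_on_generate:
  assumes "f \<in> hom G P" "h \<in> hom G P" "group P" "A \<subseteq> carrier G"
    and eq: "\<And>a. a \<in> A \<Longrightarrow> f a = h a" and x: "x \<in> generate G A"
  shows "f x = h x"
proof -
  interpret f: group_hom G P f using assms by (simp add: group_hom_def group_hom_axioms_def is_group)
  interpret h: group_hom G P h using assms by (simp add: group_hom_def group_hom_axioms_def is_group)
  show ?thesis using x
  proof (induction rule: generate.induct)
    case (inv x)
    then show ?case using assms(4) eq by (auto simp: subset_iff)
  next
    case (eng x y)
    then show ?case using generate_in_carrier[OF assms(4)] by simp
  qed (auto simp: eq)
qed

text \<open>A family of maps that is multiplicative only in the limit, with the stage depending on the two
  factors, can be corrected to true homomorphisms from some stage on: take the homomorphisms from the
  free group with the prescribed values on the finitely many generators; the finitely many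
  relators are all killed from some stage on.\<close>
theorem eventual_homs_of_finitely_presented:
  fixes \<gamma> :: "'i \<Rightarrow> 'a \<Rightarrow> 'p"
  assumes fp: "finitely_presented G" and P: "group P"
    and \<gamma>: "\<And>i x. x \<in> carrier G \<Longrightarrow> \<gamma> i x \<in> carrier P"
    and mult: "\<And>x y. x \<in> carrier G \<Longrightarrow> y \<in> carrier G \<Longrightarrow>
      \<forall>\<^sub>F i in E. \<gamma> i (x \<otimes> y) = \<gamma> i x \<otimes>\<^bsub>P\<^esub> \<gamma> i y"
  shows "\<exists>h. (\<forall>\<^sub>F i in E. h i \<in> hom G P) \<and> (\<forall>x\<in>carrier G. \<forall>\<^sub>F i in E. h i x = \<gamma> i x)"
proof -
  interpret P: group P by fact
  obtain n :: nat and R \<beta> where R: "finite R" "R \<subseteq> carrier (free_group {..<n})"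
    and \<beta>: "\<beta> \<in> iso G (free_group {..<n} Mod normal_closure (free_group {..<n}) R)"
    using fp by (auto simp: finitely_presented_def is_iso_def)
  define F where "F = free_group {..<n}"
  define K where "K = normal_closure F R"
  interpret F: group F unfolding F_def by (rule group_free_group)
  have RF: "R \<subseteq> carrier F" using R by (simp add: F_def)
  have KF: "K \<lhd> F" unfolding K_def by (rule F.normal_closure_normal[OF RF])
  interpret K: normal K F by (rule KF)
  define \<kappa> where "\<kappa> = inv_into (carrier G) \<beta>"
  have \<kappa>: "\<kappa> \<in> iso (F Mod K) G"
    using iso_set_sym[OF \<beta>] by (simp add: \<kappa>_def F_def K_def)
  define p where "p w = \<kappa> (K #>\<^bsub>F\<^esub> w)" for w
  have p: "p \<in> hom F G"
  proof (rule homI)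
    have \<kappa>h: "\<kappa> \<in> hom (F Mod K) G" using \<kappa> by (simp add: iso_def)
    fix v w assume vw: "v \<in> carrier F" "w \<in> carrier F"
    then have car: "K #>\<^bsub>F\<^esub> v \<in> carrier (F Mod K)" "K #>\<^bsub>F\<^esub> w \<in> carrier (F Mod K)"
      by (auto simp: carrier_FactGroup)
    show "p v \<in> carrier G" unfolding p_def using \<kappa>h car(1) by (rule hom_in_carrier)
    show "p (v \<otimes>\<^bsub>F\<^esub> w) = p v \<otimes> p w"
      using hom_mult[OF K.r_coset_hom_Mod vw] hom_mult[OF \<kappa>h car] by (simp add: p_def)
  qed
  interpret p: group_hom F G p using p by (simp add: group_hom_def group_hom_axioms_def F.is_group is_group)
  have surj: "\<exists>w\<in>carrier F. p w = x" if "x \<in> carrier G" for x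
  proof -
    have "x \<in> \<kappa> ` carrier (F Mod K)" using \<kappa> that by (auto simp: iso_def bij_betw_def)
    then show ?thesis by (auto simp: carrier_FactGroup p_def)
  qed
  have kerp: "w \<in> K" if "w \<in> carrier F" "p w = \<one>" for w
  proof -
    have "group (F Mod K)" by (rule K.factorgroup_is_group)
    then have "\<kappa> K = \<one>" using \<kappa> hom_one[of \<kappa> "F Mod K" G] is_group by (auto simp: iso_def)
    then have "\<kappa> (K #>\<^bsub>F\<^esub> w) = \<kappa> K" using that by (simp add: p_def)
    moreover have "inj_on \<kappa> (carrier (F Mod K))" using \<kappa> by (auto simp: iso_def bij_betw_def)
    moreover have "K #>\<^bsub>F\<^esub> w \<in> carrier (F Mod K)" "K \<in> carrier (F Mod K)"
      using that K.factorgroup_is_group group.is_monoid monoid.one_closed[of "F Mod K"]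
      by (auto simp: carrier_FactGroup)
    ultimately have "K #>\<^bsub>F\<^esub> w = K" by (auto dest: inj_onD)
    then show ?thesis using F.coset_join1 that K.subgroup_axioms by blast
  qed
  have "\<exists>h\<in>hom F P. \<forall>x\<in>{..<n}. h (gen x) = \<gamma> i (p (gen x))" for i
    unfolding F_def using gen_closed[of _ "{..<n}"] \<gamma> p.hom_closed
    by (intro P.free_group_universal) (auto simp: F_def)
  then obtain \<eta> where \<eta>: "\<And>i. \<eta> i \<in> hom F P"
    "\<And>i x. x < n \<Longrightarrow> \<eta> i (gen x) = \<gamma> i (p (gen x))" by (metis lessThan_iff)
  have \<eta>hom: "group_hom F P (\<eta> i)" for i
    using \<eta>(1) by (simp add: group_hom_def group_hom_axioms_def F.is_group P)
  have \<gamma>one: "\<forall>\<^sub>F i in E. \<gamma> i \<one> = \<one>\<^bsub>P\<^esub>"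
    using mult[OF one_closed one_closed]
  proof eventually_elim
    case (elim i)
    then show ?case using \<gamma>[OF one_closed, of i] P.r_cancel_one'[of "\<gamma> i \<one>" "\<gamma> i \<one>"] by auto
  qed
  have \<gamma>inv: "\<forall>\<^sub>F i in E. \<gamma> i (inv x) = inv\<^bsub>P\<^esub> (\<gamma> i x)" if "x \<in> carrier G" for x
    using mult[OF inv_closed[OF that] that] \<gamma>one
  proof eventually_elim
    case (elim i)
    then show ?case
      using \<gamma>[OF that, of i] \<gamma>[OF inv_closed[OF that], of i] that
      by (intro P.inv_equality[symmetric]) auto
  qed
  have agree: "\<forall>\<^sub>F i in E. \<eta> i w = \<gamma> i (p w)" if "w \<in> carrier F" for w
    using that[unfolded F_def, folded generate_gen, folded F_def]
  proof (induction rule: generate.induct)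
    case one
    show ?case using \<gamma>one
      by eventually_elim (simp add: group_hom.hom_one[OF \<eta>hom])
  next
    case (incl w)
    then show ?case by (auto simp: \<eta>)
  next
    case (inv w)
    then have w: "w \<in> carrier F" by (auto simp: F_def intro: gen_closed)
    have "\<eta> i w = \<gamma> i (p w)" for i using inv by (auto simp: \<eta>)
    then show ?case using \<gamma>inv[OF p.hom_closed[OF w]] w
      by (simp add: group_hom.hom_inv[OF \<eta>hom] eq_commute)
  next
    case (eng v w)
    have vw: "v \<in> carrier F" "w \<in> carrier F"
      using eng generate_gen[of "{..<n}"] by (auto simp: F_def)
    show ?case using eng(3,4) mult[OF p.hom_closed[OF vw(1)] p.hom_closed[OF vw(2)]]
      by eventually_elim (simp add: vw group_hom.hom_mult[OF \<eta>hom])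
  qed
  have killR: "\<forall>\<^sub>F i in E. \<forall>r\<in>R. \<eta> i r = \<one>\<^bsub>P\<^esub>"
  proof (rule eventually_ball_finite[OF R(1)], rule ballI)
    fix r assume r: "r \<in> R"
    then have rF: "r \<in> carrier F" using RF by auto
    have "r = \<one>\<^bsub>F\<^esub> \<otimes>\<^bsub>F\<^esub> r \<otimes>\<^bsub>F\<^esub> inv\<^bsub>F\<^esub> \<one>\<^bsub>F\<^esub>" using rF by simp
    then have "r \<in> K"
      unfolding K_def normal_closure_def using r F.one_closed by (blast intro: generate.incl)
    then have "p r = p \<one>\<^bsub>F\<^esub>"
      using F.coset_join2[OF rF K.subgroup_axioms] F.coset_join2[OF F.one_closed K.subgroup_axioms]
      by (simp add: p_def)
    then have pr: "p r = \<one>" by simp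
    show "\<forall>\<^sub>F i in E. \<eta> i r = \<one>\<^bsub>P\<^esub>"
      using agree[OF rF] \<gamma>one unfolding pr by eventually_elim simp
  qed
  define rep where "rep x = (SOME w. w \<in> carrier F \<and> p w = x)" for x
  have rep: "rep x \<in> carrier F" "p (rep x) = x" if "x \<in> carrier G" for x
    using someI_ex[of "\<lambda>w. w \<in> carrier F \<and> p w = x"] surj[OF that] by (auto simp: rep_def)
  define h where "h i x = \<eta> i (rep x)" for i x
  have "\<forall>\<^sub>F i in E. h i \<in> hom G P"
    using killR
  proof eventually_elim
    case (elim i)
    interpret \<eta>: group_hom F P "\<eta> i" by (rule \<eta>hom)
    have "K \<subseteq> kernel F P (\<eta> i)"
      unfolding K_def normal_closure_def
      by (rule F.generate_subgroup_incl[OF _ \<eta>.subgroup_kernel])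
        (use elim RF in \<open>auto simp: kernel_def subset_iff\<close>)
    then have K1: "\<eta> i w = \<one>\<^bsub>P\<^esub>" if "w \<in> K" for w using that by (auto simp: kernel_def)
    have same: "\<eta> i v = \<eta> i w" if "v \<in> carrier F" "w \<in> carrier F" "p v = p w" for v w
    proof -
      have "v \<otimes>\<^bsub>F\<^esub> inv\<^bsub>F\<^esub> w \<in> K" using that by (intro kerp) auto
      from K1[OF this] show ?thesis using that P.inv_equality[of "\<eta> i v" "inv\<^bsub>P\<^esub> \<eta> i w"] by simp
    qed
    show ?case
    proof (rule homI)
      fix x y assume "x \<in> carrier G" "y \<in> carrier G"
      then show "h i (x \<otimes> y) = h i x \<otimes>\<^bsub>P\<^esub> h i y"
        unfolding h_def using rep same[of "rep (x \<otimes> y)" "rep x \<otimes>\<^bsub>F\<^esub> rep y"] by simp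
    qed (simp add: h_def rep)
  qed
  moreover have "\<forall>\<^sub>F i in E. h i x = \<gamma> i x" if "x \<in> carrier G" for x
    using agree[OF rep(1)[OF that]] rep(2)[OF that] by (simp add: h_def)
  ultimately show ?thesis by blast
qed

section \<open>Finitely presented amalgams\<close>

text \<open>The permutations below act on all subsets of the group. The empty set is then a point fixed by
  every left translation, and the stabiliser of a subgroup \<open>H\<close> is \<open>H\<close>.\<close>
definition left_translation :: "'a \<Rightarrow> 'a set \<Rightarrow> 'a set" where
  "left_translation x = (\<lambda>B\<in>Pow (carrier G). (\<otimes>) x ` B)"

definition swap_with_empty :: "'a set \<Rightarrow> 'a set \<Rightarrow> 'a set" where
  "swap_with_empty H = (\<lambda>B\<in>Pow (carrier G). if B = {} then H else if B = H then {} else B)"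

lemma mult_BijGroup:
  "f \<in> carrier (BijGroup S) \<Longrightarrow> g \<in> carrier (BijGroup S) \<Longrightarrow> x \<in> S \<Longrightarrow>
    (f \<otimes>\<^bsub>BijGroup S\<^esub> g) x = f (g x)"
  by (simp add: BijGroup_def compose_def)

lemma BijGroup_eqI:
  "f \<in> carrier (BijGroup S) \<Longrightarrow> g \<in> carrier (BijGroup S) \<Longrightarrow> (\<And>x. x \<in> S \<Longrightarrow> f x = g x) \<Longrightarrow> f = g"
  by (auto simp: BijGroup_def intro: extensionalityI[OF Bij_imp_extensional Bij_imp_extensional])

lemma left_translation_hom: "left_translation \<in> hom G (BijGroup (Pow (carrier G)))"
proof -
  have im: "(\<otimes>) x ` (\<otimes>) y ` B = (\<otimes>) (x \<otimes> y) ` B"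
    if "x \<in> carrier G" "y \<in> carrier G" "B \<subseteq> carrier G" for x y B
    using that by (force simp: image_image m_assoc)
  have im1: "(\<otimes>) \<one> ` B = B" if "B \<subseteq> carrier G" for B
    using that by (force simp: image_iff)
  have cl: "(\<otimes>) x ` B \<subseteq> carrier G" if "x \<in> carrier G" "B \<subseteq> carrier G" for x B
    using that by auto
  have bij: "bij_betw (left_translation x) (Pow (carrier G)) (Pow (carrier G))" if "x \<in> carrier G" for x
    by (rule bij_betw_byWitness[where f' = "left_translation (inv x)"])
      (use that cl in \<open>auto simp: left_translation_def im im1\<close>)
  then have car: "left_translation x \<in> carrier (BijGroup (Pow (carrier G)))" if "x \<in> carrier G" for x
    using that by (auto simp: BijGroup_def Bij_def left_translation_def)
  show ?thesis
  proof (rule homI)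
    fix x y assume xy: "x \<in> carrier G" "y \<in> carrier G"
    show "left_translation (x \<otimes> y) =
        left_translation x \<otimes>\<^bsub>BijGroup (Pow (carrier G))\<^esub> left_translation y"
      by (rule BijGroup_eqI)
        (use xy car cl in \<open>auto simp: mult_BijGroup left_translation_def im
          intro!: group.is_monoid[OF group_BijGroup, THEN monoid.m_closed]\<close>)
  qed (rule car)
qed

lemma swap_with_empty_closed:
  "H \<subseteq> carrier G \<Longrightarrow> swap_with_empty H \<in> carrier (BijGroup (Pow (carrier G)))"
proof -
  assume H: "H \<subseteq> carrier G"
  have "bij_betw (swap_with_empty H) (Pow (carrier G)) (Pow (carrier G))"
    by (rule bij_betw_byWitness[where f' = "swap_with_empty H"])
      (use H in \<open>auto simp: swap_with_empty_def\<close>)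
  then show ?thesis by (auto simp: BijGroup_def Bij_def swap_with_empty_def)
qed

text \<open>Interchanging the point \<open>H\<close> with a global fixed point commutes with a translation exactly when
  the translation fixes \<open>H\<close> as well. Conjugating the translation action by this interchange
  produces a second action that agrees with the first one on \<open>H\<close> and nowhere else.\<close>
lemma left_translation_commutes_iff:
  assumes H: "subgroup H G" and x: "x \<in> carrier G"
  defines "P \<equiv> BijGroup (Pow (carrier G))"
  shows "group.conj_by P (swap_with_empty H) (left_translation x) = left_translation x \<longleftrightarrow> x \<in> H"
proof -
  interpret P: group P unfolding P_def by (rule group_BijGroup)
  have Hc: "H \<subseteq> carrier G" using H by (simp add: subgroup.subset)
  have sw: "swap_with_empty H \<in> carrier P" unfolding P_def by (rule swap_with_empty_closed[OF Hc])
  have lt: "left_translation x \<in> carrier P"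
    unfolding P_def using left_translation_hom x by (rule hom_in_carrier)
  have mH: "(\<otimes>) m ` H = H" if "m \<in> H" for m
    using coset_join3[OF _ H that] that Hc by (auto simp: l_coset_def)
  have mB: "B = H" if "m \<in> H" "(\<otimes>) m ` B = H" "B \<subseteq> carrier G" for m B
  proof -
    have "B = (\<otimes>) (inv m) ` (\<otimes>) m ` B" using that Hc by (force simp: image_image subset_iff)
    then show ?thesis using that mH[of "inv m"] subgroup.m_inv_closed[OF H that(1)] by simp
  qed
  have "P.conj_by (swap_with_empty H) (left_translation x) = left_translation x \<longleftrightarrow>
    swap_with_empty H \<otimes>\<^bsub>P\<^esub> left_translation x = left_translation x \<otimes>\<^bsub>P\<^esub> swap_with_empty H"
    unfolding P.conj_by_def using sw lt by (metis P.inv_solve_right P.m_closed)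
  also have "\<dots> \<longleftrightarrow> x \<in> H"
  proof
    assume "swap_with_empty H \<otimes>\<^bsub>P\<^esub> left_translation x = left_translation x \<otimes>\<^bsub>P\<^esub> swap_with_empty H"
    then have "swap_with_empty H (left_translation x {}) = left_translation x (swap_with_empty H {})"
      using sw lt mult_BijGroup[of _ "Pow (carrier G)" _ "{}"] unfolding P_def by (metis empty_subsetI PowI)
    then have "H = (\<otimes>) x ` H" using Hc by (simp add: swap_with_empty_def left_translation_def)
    then have "x \<otimes> \<one> \<in> H" using subgroup.one_closed[OF H] by blast
    then show "x \<in> H" using x by simp
  next
    assume xH: "x \<in> H"
    show "swap_with_empty H \<otimes>\<^bsub>P\<^esub> left_translation x = left_translation x \<otimes>\<^bsub>P\<^esub> swap_with_empty H"
    proof (rule BijGroup_eqI[of _ "Pow (carrier G)"])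
      fix B assume B: "B \<in> Pow (carrier G)"
      have 1: "(\<otimes>) x ` B \<subseteq> carrier G" using B x by auto
      have "swap_with_empty H (left_translation x B) = left_translation x (swap_with_empty H B)"
      proof (cases "B = {} \<or> B = H")
        case True
        then show ?thesis
          using Hc mH[OF xH] by (auto simp: swap_with_empty_def left_translation_def)
      next
        case False
        moreover from this have "(\<otimes>) x ` B \<noteq> H" using mB[OF xH, of B] B by blast
        ultimately show ?thesis using B 1 by (simp add: swap_with_empty_def left_translation_def)
      qed
      then show "(swap_with_empty H \<otimes>\<^bsub>P\<^esub> left_translation x) B =
        (left_translation x \<otimes>\<^bsub>P\<^esub> swap_with_empty H) B"
        using sw lt B unfolding P_def by (simp add: mult_BijGroup)
    qed (use sw lt P_def P.m_closed in auto)
  qed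
  finally show ?thesis .
qed

text \<open>Modulo its kernel \<open>M\<close>, the group is free on the images of \<open>u 0\<close> and \<open>u 1\<close>; it is thus the
  amalgam of \<open>N\<^sub>0 = \<langle>M, u 0\<rangle>\<close> and \<open>N\<^sub>1 = \<langle>M, u 1\<rangle>\<close> over \<open>M\<close>, and by hypothesis \<open>N\<^sub>0\<close> and \<open>N\<^sub>1\<close> are
  finitely generated. The theorem is an instance of Baumslag's principle: a finitely presented amalgam of two
  finitely generated groups is amalgamated over a finitely generated group.

  For a finite \<open>A \<subseteq> M\<close>, let \<open>N\<^sub>0\<close> act by left translation and let \<open>N\<^sub>1\<close> act by left translation
  conjugated by the interchange of the empty set with the subgroup generated by \<open>A\<close>. On \<open>M\<close> the two
  actions agree exactly on the subgroup generated by \<open>A\<close>, hence at each given element of \<open>M\<close> once \<open>A\<close> is large. So they fit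
  together to a map on the amalgam that is multiplicative in the limit. By finite presentability it
  can be replaced by a homomorphism for a suitable finite \<open>A\<close>. As \<open>N\<^sub>0\<close> and \<open>N\<^sub>1\<close> are
  finitely generated, this homomorphism can be made to restrict to the two given actions, which
  must therefore agree on all of \<open>M\<close>; so \<open>A\<close> generates \<open>M\<close>.\<close>
theorem finitely_generated_edge_group:
  fixes \<pi> :: "'a \<Rightarrow> nat word" and u :: "nat \<Rightarrow> 'a"
  assumes \<pi>: "\<pi> \<in> hom G (free_group {..<2})"
    and u: "\<And>i. i < 2 \<Longrightarrow> u i \<in> carrier G" "\<And>i. i < 2 \<Longrightarrow> \<pi> (u i) = gen i"
    and W: "\<And>i. i < 2 \<Longrightarrow> finite (W i)" "\<And>i. i < 2 \<Longrightarrow> W i \<subseteq> kernel G (free_group {..<2}) \<pi>"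
      "\<And>i. i < 2 \<Longrightarrow> kernel G (free_group {..<2}) \<pi> \<subseteq> generate G (insert (u i) (W i))"
    and fp: "finitely_presented G"
  shows "finitely_generated (G\<lparr>carrier := kernel G (free_group {..<2}) \<pi>\<rparr>)"
proof -
  define E :: "nat word monoid" where "E = free_group {..<2}"
  define M where "M = kernel G E \<pi>"
  define P where "P = BijGroup (Pow (carrier G))"
  interpret E: group E unfolding E_def by (rule group_free_group)
  interpret P: group P unfolding P_def by (rule group_BijGroup)
  interpret \<pi>: group_hom G E \<pi>
    using \<pi> by (simp add: group_hom_def group_hom_axioms_def is_group E.is_group flip: E_def)
  interpret lt: group_hom G P left_translation
    using left_translation_hom
    by (simp add: group_hom_def group_hom_axioms_def is_group P.is_group flip: P_def)
  have M: "subgroup M G" unfolding M_def by (rule \<pi>.subgroup_kernel)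
  have Mc: "m \<in> carrier G" "\<pi> m = \<one>\<^bsub>E\<^esub>" if "m \<in> M" for m using that by (auto simp: M_def kernel_def)
  have Mconj: "conj_by g m \<in> M" if "g \<in> carrier G" "m \<in> M" for g m
    using that by (auto simp: M_def kernel_def conj_by_def)
  have W': "w \<in> M" if "i < 2" "w \<in> W i" for i w using W(2)[OF that(1)] that(2) by (auto simp: M_def E_def)
  have WM: "M \<subseteq> generate G (insert (u i) (W i))" if "i < 2" for i
    using W(3)[OF that] by (simp add: M_def E_def)
  have gens: "generate E (gen ` {..<2}) = carrier E" unfolding E_def by (rule generate_gen)
  have genc: "gen i \<in> carrier E" if "i < 2" for i using that by (auto simp: E_def intro: gen_closed)
  obtain \<sigma> where \<sigma>: "\<sigma> \<in> hom E G" "\<And>i. i < 2 \<Longrightarrow> \<sigma> (gen i) = u i"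
    using free_group_universal[of u "{..<2}"] u(1) by (auto simp: E_def)
  interpret \<sigma>: group_hom E G \<sigma>
    using \<sigma>(1) by (simp add: group_hom_def group_hom_axioms_def is_group E.is_group)
  have \<pi>\<sigma>: "\<pi> (\<sigma> q) = q" if "q \<in> carrier E" for q
  proof -
    have "(\<lambda>q. \<pi> (\<sigma> q)) \<in> hom E E" "(\<lambda>q. q) \<in> hom E E" by (auto intro!: homI)
    then show ?thesis
      by (rule E.homs_eq_on_generate[where A = "gen ` {..<2}"])
        (use that in \<open>auto simp: E.is_group gens genc u \<sigma>\<close>)
  qed
  define sw where "sw A = swap_with_empty (generate G A)" for A
  define \<F> where "\<F> = finite_subsets_at_top M"
  have swc: "sw A \<in> carrier P" if "A \<subseteq> M" for A
    unfolding sw_def P_def using that M by (intro swap_with_empty_closed generate_incl) (auto intro: subgroup.mem_carrier)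
  have ev\<F>: "\<forall>\<^sub>F A in \<F>. finite A \<and> A \<subseteq> M"
    unfolding \<F>_def by (auto simp: eventually_finite_subsets_at_top)
  have ev_mem: "\<forall>\<^sub>F A in \<F>. m \<in> A" if "m \<in> M" for m
    unfolding \<F>_def eventually_finite_subsets_at_top using that by (intro exI[of _ "{m}"]) auto
  have commute: "P.conj_by (sw A) (left_translation m) = left_translation m \<longleftrightarrow> m \<in> generate G A"
    if "A \<subseteq> M" "m \<in> carrier G" for A m
    unfolding sw_def P_def using that M
    by (intro left_translation_commutes_iff generate_is_subgroup) (auto intro: subgroup.mem_carrier)
  have ev_comm: "\<forall>\<^sub>F A in \<F>. A \<subseteq> M \<and> P.conj_by (sw A) (left_translation m) = left_translation m"
    if "m \<in> M" for m
    using ev\<F> ev_mem[OF that] by eventually_elim (simp add: commute Mc[OF that] generate.incl)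
  \<comment> \<open>The value for \<open>A\<close> outside \<open>M\<close> is a dummy that lies in the permutation group.\<close>
  define f where "f A i = (if i = (0::nat) \<or> \<not> A \<subseteq> M then left_translation (u i)
    else P.conj_by (sw A) (left_translation (u i)))" for A i
  have "\<exists>h\<in>hom E P. \<forall>i\<in>{..<2}. h (gen i) = f A i" for A
    unfolding E_def using u swc by (intro P.free_group_universal) (auto simp: f_def)
  then obtain \<delta> where \<delta>: "\<And>A. \<delta> A \<in> hom E P" "\<And>A i. i < 2 \<Longrightarrow> \<delta> A (gen i) = f A i"
    by (metis lessThan_iff)
  have \<delta>hom: "group_hom E P (\<delta> A)" for A
    using \<delta>(1) by (simp add: group_hom_def group_hom_axioms_def E.is_group P.is_group)
  have \<delta>c: "\<delta> A q \<in> carrier P" if "q \<in> carrier E" for A q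
    using group_hom.hom_closed[OF \<delta>hom that] .
  have lt_conj: "left_translation (conj_by g m) = P.conj_by (left_translation g) (left_translation m)"
    if "g \<in> carrier G" "m \<in> carrier G" for g m
    using that by (simp add: conj_by_def P.conj_by_def)
  \<comment> \<open>Conjugation by \<open>\<delta> A (gen 1)\<close> and by \<open>u 1\<close> agree on each element of \<open>M\<close> once \<open>A\<close> is large.\<close>
  have gen_case: "\<forall>\<^sub>F A in \<F>. P.conj_by (\<delta> A (gen i)) (left_translation m) =
    left_translation (conj_by (\<sigma> (gen i)) m)" if i: "i < 2" and m: "m \<in> M" for i m
  proof (cases "i = 0")
    case True
    then show ?thesis using i m by (simp add: \<delta> \<sigma> f_def lt_conj u Mc)
  next
    case False
    have m': "conj_by (u i) m \<in> M" using Mconj u i m by auto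
    show ?thesis using ev_comm[OF m] ev_comm[OF m']
    proof eventually_elim
      case (elim A)
      let ?s = "sw A" and ?a = "left_translation (u i)" and ?b = "left_translation m"
      have c: "?s \<in> carrier P" "?a \<in> carrier P" "?b \<in> carrier P"
        using elim swc u i Mc[OF m] by auto
      have "P.conj_by (P.conj_by ?s ?a) ?b = P.conj_by (P.conj_by ?s ?a) (P.conj_by ?s ?b)"
        using elim by simp
      also have "\<dots> = P.conj_by ?s (P.conj_by ?a ?b)"
        using c by (simp add: P.conj_by_def P.m_assoc P.inv_mult_group)
      also have "\<dots> = left_translation (conj_by (u i) m)"
        using elim u i Mc[OF m] by (simp flip: lt_conj)
      finally show ?case using False elim i by (simp add: \<delta> \<sigma> f_def)
    qed
  qed
  have ev_conj: "\<forall>m\<in>M. \<forall>\<^sub>F A in \<F>. P.conj_by (\<delta> A q) (left_translation m) =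
    left_translation (conj_by (\<sigma> q) m)" if "q \<in> carrier E" for q
    using that[folded gens]
  proof (induction rule: generate.induct)
    case one
    then show ?case by (auto simp: group_hom.hom_one[OF \<delta>hom] Mc)
  next
    case (incl q)
    then show ?case using gen_case by auto
  next
    case (inv q)
    then obtain i where i: "q = gen i" "i < 2" by auto
    have q: "q \<in> carrier E" using i genc by auto
    show ?case
    proof
      fix m assume m: "m \<in> M"
      let ?m = "conj_by (\<sigma> (inv\<^bsub>E\<^esub> q)) m"
      have m': "?m \<in> M" using m q by (intro Mconj) auto
      show "\<forall>\<^sub>F A in \<F>. P.conj_by (\<delta> A (inv\<^bsub>E\<^esub> q)) (left_translation m) = left_translation ?m"
        using gen_case[OF i(2) m']
      proof eventually_elim
        case (elim A)
        have "left_translation m = P.conj_by (\<delta> A q) (left_translation ?m)"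
          using elim q m Mc[OF m] by (simp add: i(1)[symmetric] conj_by_conj_by)
        then show ?case
          using q \<delta>c[OF q] Mc[OF m'] Mc[OF m]
          by (simp add: group_hom.hom_inv[OF \<delta>hom] P.conj_by_conj_by)
      qed
    qed
  next
    case (eng p q)
    have pq: "p \<in> carrier E" "q \<in> carrier E" using eng gens by auto
    show ?case
    proof
      fix m assume m: "m \<in> M"
      have m': "conj_by (\<sigma> q) m \<in> M" using m pq by (intro Mconj) auto
      show "\<forall>\<^sub>F A in \<F>. P.conj_by (\<delta> A (p \<otimes>\<^bsub>E\<^esub> q)) (left_translation m) =
          left_translation (conj_by (\<sigma> (p \<otimes>\<^bsub>E\<^esub> q)) m)"
        using eng(3)[rule_format, OF m'] eng(4)[rule_format, OF m]
        by eventually_elim (use pq Mc[OF m] \<delta>c in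
          \<open>simp add: group_hom.hom_mult[OF \<delta>hom] conj_by_conj_by flip: P.conj_by_conj_by\<close>)
    qed
  qed
  \<comment> \<open>The component in \<open>M\<close> with respect to the section \<open>\<sigma>\<close> of \<open>\<pi>\<close>.\<close>
  define part where "part x = x \<otimes> inv (\<sigma> (\<pi> x))" for x
  have part: "part x \<in> M" if "x \<in> carrier G" for x
    using that by (auto simp: part_def M_def kernel_def \<pi>\<sigma>)
  define \<gamma> where "\<gamma> A x = left_translation (part x) \<otimes>\<^bsub>P\<^esub> \<delta> A (\<pi> x)" for A x
  have \<gamma>c: "\<gamma> A x \<in> carrier P" if "x \<in> carrier G" for A x
    using that \<delta>c Mc part by (simp add: \<gamma>_def)
  have \<gamma>mult: "\<forall>\<^sub>F A in \<F>. \<gamma> A (x \<otimes> y) = \<gamma> A x \<otimes>\<^bsub>P\<^esub> \<gamma> A y"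
    if xy: "x \<in> carrier G" "y \<in> carrier G" for x y
    using ev_conj[OF \<pi>.hom_closed[OF xy(1)], rule_format, OF part[OF xy(2)]]
  proof eventually_elim
    case (elim A)
    have "part (x \<otimes> y) = part x \<otimes> conj_by (\<sigma> (\<pi> x)) (part y)"
      using xy by (simp add: part_def conj_by_def inv_mult_group m_assoc)
    then have "\<gamma> A (x \<otimes> y) = left_translation (part x) \<otimes>\<^bsub>P\<^esub>
        P.conj_by (\<delta> A (\<pi> x)) (left_translation (part y)) \<otimes>\<^bsub>P\<^esub> (\<delta> A (\<pi> x) \<otimes>\<^bsub>P\<^esub> \<delta> A (\<pi> y))"
      using xy Mc(1)[OF part] elim by (simp add: \<gamma>_def group_hom.hom_mult[OF \<delta>hom])
    then show ?case
      using xy Mc(1)[OF part] \<delta>c by (simp add: \<gamma>_def P.conj_by_def P.m_assoc)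
  qed
  obtain h where h: "\<forall>\<^sub>F A in \<F>. h A \<in> hom G P"
    "\<And>x. x \<in> carrier G \<Longrightarrow> \<forall>\<^sub>F A in \<F>. h A x = \<gamma> A x"
    using eventual_homs_of_finitely_presented[OF fp P.is_group, of \<gamma> \<F>] \<gamma>c \<gamma>mult by blast
  have \<gamma>M: "\<gamma> A m = left_translation m" if "m \<in> M" for A m
    using Mc[OF that] by (simp add: \<gamma>_def part_def group_hom.hom_one[OF \<delta>hom])
  have \<gamma>u: "\<gamma> A (u i) = f A i" if "i < 2" for A i
    using that u \<delta>c[OF genc[OF that]] by (simp add: \<gamma>_def part_def \<delta> \<sigma>)
  have h0: "\<forall>\<^sub>F A in \<F>. \<forall>w\<in>W 0. h A w = left_translation w"
  proof (rule eventually_ball_finite, safe)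
    fix w assume "w \<in> W 0"
    then have w: "w \<in> M" using W'[of 0 w] by simp
    show "\<forall>\<^sub>F A in \<F>. h A w = left_translation w" using h(2)[OF Mc(1)[OF w]] by (simp add: \<gamma>M w)
  qed (use W in auto)
  have h1: "\<forall>\<^sub>F A in \<F>. \<forall>w\<in>W 1. h A w = P.conj_by (sw A) (left_translation w)"
  proof (rule eventually_ball_finite, safe)
    fix w assume "w \<in> W 1"
    then have w: "w \<in> M" using W'[of 1 w] by simp
    show "\<forall>\<^sub>F A in \<F>. h A w = P.conj_by (sw A) (left_translation w)"
      using h(2)[OF Mc(1)[OF w]] ev_comm[OF w] by eventually_elim (simp add: \<gamma>M w)
  qed (use W in auto)
  have hu: "\<forall>\<^sub>F A in \<F>. h A (u 0) = \<gamma> A (u 0)" "\<forall>\<^sub>F A in \<F>. h A (u 1) = \<gamma> A (u 1)"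
    by (intro h(2) u; simp)+
  have "\<forall>\<^sub>F A in \<F>. finite A \<and> A \<subseteq> M \<and> M \<subseteq> generate G A"
    using ev\<F> h(1) h0 h1 hu
  proof eventually_elim
    case (elim A)
    have sA: "sw A \<in> carrier P" using elim swc by blast
    have Wc: "insert (u i) (W i) \<subseteq> carrier G" if "i < 2" for i using that u W' Mc by auto
    have ch: "(\<lambda>x. P.conj_by (sw A) (left_translation x)) \<in> hom G P"
      using sA by (auto intro!: homI simp: P.conj_by_mult)
    have "m \<in> generate G A" if m: "m \<in> M" for m
    proof -
      have "h A m = left_translation m"
        by (rule homs_eq_on_generate[OF _ lt.homh P.is_group Wc[of 0]])
          (use elim m WM[of 0] in \<open>auto simp: \<gamma>u f_def\<close>)
      moreover have "h A m = P.conj_by (sw A) (left_translation m)"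
        by (rule homs_eq_on_generate[OF _ ch P.is_group Wc[of 1]])
          (use elim m WM[of 1] in \<open>auto simp: \<gamma>u f_def\<close>)
      ultimately show ?thesis using commute[of A m] elim Mc[OF m] by simp
    qed
    then show ?case using elim by auto
  qed
  then have "\<exists>A. finite A \<and> A \<subseteq> M \<and> M \<subseteq> generate G A"
    unfolding \<F>_def by (rule eventually_happens'[OF finite_subsets_at_top_neq_bot])
  then obtain A where A: "finite A" "A \<subseteq> M" "M \<subseteq> generate G A" by blast
  then have "generate G A = M" using generate_subgroup_incl[OF A(2) M] by auto
  with A show ?thesis
    unfolding E_def[symmetric] M_def[symmetric] finitely_generated_subgroup_iff[OF M] by blast
qed

section \<open>Fibering and incoherence from excess homology\<close>

text \<open>A character \<open>F\<close> that does not vanish on the finitely generated normal subgroup \<open>L\<close> is excess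
  homology compared with the quotient by \<open>L\<close>. A small perturbation by \<open>F\<close> of a large multiple of the
  character \<open>\<tau>\<close> of the quotient has a finitely generated kernel: that kernel is generated by finitely many
  corrected generators and by \<open>L \<inter> ker F\<close>, and the latter is swept out by one of them.\<close>
theorem algebraically_fibers_if_excessive:
  assumes L: "L \<lhd> G" "finite S" "generate G S = L" "S \<subseteq> carrier G"
    and F: "F \<in> hom G integer_group" and s: "s \<in> L" "F s = 1"
    and \<tau>: "\<tau> \<in> hom G integer_group" "\<And>x. x \<in> L \<Longrightarrow> \<tau> x = 0"
    and T: "finite T" "T \<subseteq> carrier G" "generate G (L \<union> T) = carrier G"
    and t: "t \<in> carrier G" "\<tau> t > 0" 
  shows "algebraically_fibers G"
proof -
  obtain c W where W: "finite W" "W \<subseteq> {x \<in> L. F x = 0}"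
    "{x \<in> L. F x = 0} \<subseteq> generate G (insert (t \<otimes> inv (s [^] (F t + c * \<tau> t))) W)"
    using sweep_kernel_large[OF L F s, of t \<tau>, OF t] by blast
  define \<psi> where "\<psi> x = F x + c * \<tau> x" for x
  have \<psi>: "\<psi> \<in> hom G integer_group"
    using hom_add_integer_group[OF F \<tau>(1)] by (simp add: \<psi>_def[abs_def])
  have \<psi>L: "\<psi> x = F x" if "x \<in> L" for x using that \<tau> by (simp add: \<psi>_def)
  have Lc: "L \<subseteq> carrier G" using subgroup.subset[OF normal_imp_subgroup[OF L(1)]] .
  then have sc: "s \<in> carrier G" using s by auto
  have MF: "{x \<in> L. F x = 0} = {x \<in> L. \<psi> x = 0}" using \<psi>L by auto
  have "L \<union> insert t T \<subseteq> carrier G"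
    using Lc T(2) t(1) by auto
  then have gen: "generate G (L \<union> insert t T) = carrier G"
    using mono_generate[of "L \<union> T" "L \<union> insert t T"] T(3) generate_incl by blast
  have "finitely_generated (G\<lparr>carrier := kernel G integer_group \<psi>\<rparr>)"
    by (rule kernel_finite_generators[OF L(1) \<psi> s(1) _ _ _ gen _ W[unfolded MF, folded \<psi>_def]])
      (use T t s \<psi>L in \<open>auto simp: \<psi>_def\<close>)
  moreover have "k \<in> \<psi> ` carrier G" for k
    using hom_integer_group(4)[OF \<psi> sc, of k] s \<psi>L sc by (intro image_eqI[of _ _ "s [^] k"]) auto
  ultimately show ?thesis
    using \<psi> by (auto simp: algebraically_fibers_def epi_def)
qed

text \<open>The kernel of \<open>F + c \<tau>\<close> for large \<open>c\<close> is finitely generated as before. It still maps onto the free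
  group with kernel \<open>M = L \<inter> ker F\<close>, and sweeping with either of the two corrected lifts
  shows that \<open>\<langle>M, u 0\<rangle>\<close> and \<open>\<langle>M, u 1\<rangle>\<close> are finitely generated. If the kernel were finitely presented,
  then \<open>M\<close> would be finitely generated.\<close>
theorem incoherent_if_excessive:
  fixes t :: "nat \<Rightarrow> 'a"
  assumes L: "finite S" "S \<subseteq> carrier G"
      "generate G S = kernel G (free_group {..<2}) \<pi>"
    and \<pi>: "\<pi> \<in> hom G (free_group {..<2})"
    and F: "F \<in> hom G integer_group" and s: "s \<in> generate G S" "F s = 1"
    and \<tau>: "\<tau> \<in> hom G integer_group" "\<And>x. x \<in> generate G S \<Longrightarrow> \<tau> x = 0"
    and t: "\<And>i. i < 2 \<Longrightarrow> t i \<in> carrier G" "\<And>i. i < 2 \<Longrightarrow> \<pi> (t i) = gen i"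
      "\<And>i. i < 2 \<Longrightarrow> \<tau> (t i) > 0"
    and nfg: "\<not> finitely_generated (G\<lparr>carrier := {x \<in> generate G S. F x = 0}\<rparr>)"
  shows "incoherent G"
proof -
  define E :: "nat word monoid" where "E = free_group {..<2}"
  interpret E: group E unfolding E_def by (rule group_free_group)
  interpret \<pi>: group_hom G E \<pi>
    using \<pi> by (simp add: group_hom_def group_hom_axioms_def is_group E.is_group flip: E_def)
  define L where "L = kernel G E \<pi>"
  have LS: "generate G S = L" using L(3) by (simp add: L_def E_def)
  have nL: "L \<lhd> G" unfolding L_def by (rule \<pi>.normal_kernel)
  have Lc: "x \<in> carrier G" "\<pi> x = \<one>\<^bsub>E\<^esub>" if "x \<in> L" for x using that by (auto simp: L_def kernel_def)
  note s = s[unfolded LS] and \<tau> = \<tau>[unfolded LS] and nfg = nfg[unfolded LS]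
  let ?M = "{x \<in> L. F x = 0}"
  have "\<forall>i\<in>{..<2}. \<exists>D. \<forall>c\<ge>D. \<exists>W. finite W \<and> W \<subseteq> ?M \<and>
    ?M \<subseteq> generate G (insert (t i \<otimes> inv (s [^] (F (t i) + c * \<tau> (t i)))) W)"
    using sweep_kernel_large[OF nL L(1) LS L(2) F s] t by auto
  note bchoice[OF this]
  then obtain D where D: "\<And>i c. i < 2 \<Longrightarrow> c \<ge> D i \<Longrightarrow> \<exists>W. finite W \<and> W \<subseteq> ?M \<and>
    ?M \<subseteq> generate G (insert (t i \<otimes> inv (s [^] (F (t i) + c * \<tau> (t i)))) W)"
    by blast
  define c where "c = max (D 0) (D 1)"
  define \<psi> where "\<psi> x = F x + c * \<tau> x" for x
  define u where "u i = t i \<otimes> inv (s [^] \<psi> (t i))" for i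
  have \<psi>: "\<psi> \<in> hom G integer_group"
    using hom_add_integer_group[OF F \<tau>(1)] by (simp add: \<psi>_def[abs_def])
  note \<psi>h = hom_integer_group[OF \<psi>]
  have \<psi>L: "\<psi> x = F x" if "x \<in> L" for x using that \<tau> by (simp add: \<psi>_def)
  have sc: "s \<in> carrier G" using s Lc by auto
  have MF: "?M = {x \<in> L. \<psi> x = 0}" using \<psi>L by auto
  have "\<forall>i\<in>{..<2}. \<exists>W. finite W \<and> W \<subseteq> ?M \<and> ?M \<subseteq> generate G (insert (u i) W)"
  proof
    fix i :: nat
    assume "i \<in> {..<2}"
    then have i: "i < 2" and "D i \<le> c" by (auto simp: c_def less_2_cases_iff)
    from D[OF this]
    show "\<exists>W. finite W \<and> W \<subseteq> ?M \<and> ?M \<subseteq> generate G (insert (u i) W)"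
      unfolding u_def \<psi>_def .
  qed
  note bchoice[OF this]
  then obtain W where "\<forall>i\<in>{..<2}. finite (W i) \<and> W i \<subseteq> ?M \<and> ?M \<subseteq> generate G (insert (u i) (W i))"
    by (rule exE)
  then have W: "\<And>i. i < 2 \<Longrightarrow> finite (W i)" "\<And>i. i < 2 \<Longrightarrow> W i \<subseteq> ?M"
    "\<And>i. i < 2 \<Longrightarrow> ?M \<subseteq> generate G (insert (u i) (W i))"
    by (simp_all only: lessThan_iff Ball_def)
  define K where "K = kernel G integer_group \<psi>"
  have K: "subgroup K G"
    unfolding K_def using \<psi> by (intro group_hom.subgroup_kernel)
      (simp add: group_hom_def group_hom_axioms_def is_group)
  have uK: "u i \<in> K" if "i < 2" for i
    using t[OF that] sc s(2) \<psi>L[OF s(1)] by (auto simp: u_def K_def kernel_def \<psi>h)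
  have MK: "?M \<subseteq> K" by (auto simp: K_def kernel_def Lc \<psi>L)
  have gens: "generate G (L \<union> t ` {..<2}) = carrier G"
  proof
    have tc: "t ` {..<2} \<subseteq> carrier G" using t by auto
    then have ic: "L \<union> t ` {..<2} \<subseteq> carrier G" using Lc by auto
    then show "generate G (L \<union> t ` {..<2}) \<subseteq> carrier G" by (rule generate_incl)
    show "carrier G \<subseteq> generate G (L \<union> t ` {..<2})"
    proof
      fix x assume x: "x \<in> carrier G"
      have "\<pi> ` t ` {..<2} = gen ` {..<2}" using t by (auto simp: image_image)
      then have "\<pi> ` generate G (t ` {..<2}) = carrier E"
        using \<pi>.generate_img[OF tc] generate_gen[of "{..<2::nat}"] by (simp add: E_def)
      moreover have "\<pi> x \<in> carrier E" using x by simp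
      ultimately obtain y where y: "y \<in> generate G (t ` {..<2})" "\<pi> x = \<pi> y" by (metis imageE)
      have yc: "y \<in> carrier G" using y generate_incl[OF tc] by auto
      have "x \<otimes> inv y \<in> L" using x yc y by (simp add: L_def kernel_def)
      moreover have "y \<in> generate G (L \<union> t ` {..<2})" using y mono_generate[of "t ` {..<2}"] by blast
      ultimately have "x \<otimes> inv y \<otimes> y \<in> generate G (L \<union> t ` {..<2})"
        by (intro generate.eng[of "x \<otimes> inv y"] generate.incl[of "x \<otimes> inv y"]) auto
      then show "x \<in> generate G (L \<union> t ` {..<2})" using x yc by (simp add: m_assoc)
    qed
  qed
  have fg: "finitely_generated (G\<lparr>carrier := K\<rparr>)"
    unfolding K_def
    by (rule kernel_finite_generators[OF nL \<psi> s(1) _ _ _ gens _ W(1)[of 0] W(2)[of 0, unfolded MF]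
          W(3)[of 0, unfolded MF u_def]])
      (use t s \<psi>L in auto)
  have "\<not> finitely_presented (G\<lparr>carrier := K\<rparr>)"
  proof
    assume fp: "finitely_presented (G\<lparr>carrier := K\<rparr>)"
    interpret K: group "G\<lparr>carrier := K\<rparr>" using subgroup_imp_group[OF K] .
    have ker: "kernel (G\<lparr>carrier := K\<rparr>) E \<pi> = ?M"
      using MK by (auto simp: kernel_def L_def K_def \<psi>L)
    have \<pi>u: "\<pi> (u i) = gen i" if "i < 2" for i
    proof -
      have "s [^] j \<in> L" for j :: int
        using s(1) nL by (simp add: subgroup_int_pow_closed normal_imp_subgroup)
      moreover have "gen i \<in> carrier E" using that unfolding E_def by (intro gen_closed) simp
      ultimately show ?thesis using t[OF that] Lc by (simp add: u_def)
    qed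
    have "finitely_generated (G\<lparr>carrier := K, carrier := kernel (G\<lparr>carrier := K\<rparr>) (free_group {..<2}) \<pi>\<rparr>)"
    proof (rule K.finitely_generated_edge_group[where u = u and W = W])
      show "\<pi> \<in> hom (G\<lparr>carrier := K\<rparr>) (free_group {..<2})"
        using \<pi> K by (auto simp: hom_def subgroup.mem_carrier)
      show "kernel (G\<lparr>carrier := K\<rparr>) (free_group {..<2}) \<pi> \<subseteq>
          generate (G\<lparr>carrier := K\<rparr>) (insert (u i) (W i))" if "i < 2" for i
      proof -
        have "insert (u i) (W i) \<subseteq> K" using uK W(2) MK that by blast
        then show ?thesis using ker W(3)[OF that] generate_consistent[OF _ K] by (simp add: E_def)
      qed
      show "W i \<subseteq> kernel (G\<lparr>carrier := K\<rparr>) (free_group {..<2}) \<pi>" if "i < 2" for i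
        using W(2)[OF that] ker by (simp add: E_def)
    qed (use uK \<pi>u W(1) fp in auto)
    then show False using ker nfg by (simp add: E_def)
  qed
  then show ?thesis using fg K by (auto simp: coherent_def)
qed

lemma coherent_subgroup:
  assumes H: "subgroup H G" and "coherent G"
  shows "coherent (G\<lparr>carrier := H\<rparr>)"
  using assms incl_subgroup[OF H] by (auto simp: coherent_def)

end

section \<open>The free group of rank two over the infinite dihedral group\<close>

text \<open>The pair \<open>(e, k)\<close> stands for the element \<open>x \<mapsto> e x + k\<close> of the infinite dihedral group acting on
  the integers, and \<open>h\<close> is a finitely supported function on the integers: the group is the
  permutational wreath product of the integers with the infinite dihedral group.\<close>
definition dihedral_wreath :: "(int \<times> int \<times> (int \<Rightarrow> int)) monoid" where
  "dihedral_wreath =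
    \<lparr>carrier = {1, -1} \<times> UNIV \<times> {h. finite {x. h x \<noteq> 0}},
     mult = (\<lambda>(e, k, h) (e', k', h'). (e * e', k + e * k', \<lambda>x. h x + h' (e * (x - k)))),
     one = (1, 0, \<lambda>_. 0)\<rparr>"

lemma finite_support_affine:
  assumes "finite {x. h x \<noteq> (0::int)}" "e \<in> {1, -1 :: int}"
  shows "finite {x. h (e * (x - k)) \<noteq> 0}"
proof -
  have "inj (\<lambda>x. e * (x - k))" using assms(2) by (auto simp: inj_def)
  from finite_vimageI[OF assms(1) this] show ?thesis by (simp add: vimage_def)
qed

lemma group_dihedral_wreath: "group dihedral_wreath"
proof (rule groupI)
  fix x y assume "x \<in> carrier dihedral_wreath" "y \<in> carrier dihedral_wreath"
  then obtain e k h e' k' h' where xy: "x = (e, k, h)" "y = (e', k', h')" "e \<in> {1,-1}" "e' \<in> {1,-1}"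
    "finite {x. h x \<noteq> 0}" "finite {x. h' x \<noteq> 0}"
    by (auto simp: dihedral_wreath_def)
  have "finite {x. h x + h' (e * (x - k)) \<noteq> 0}"
    by (rule finite_subset[OF _ finite_UnI[OF xy(5) finite_support_affine[OF xy(6,3), of k]]]) auto
  then show "x \<otimes>\<^bsub>dihedral_wreath\<^esub> y \<in> carrier dihedral_wreath"
    using xy(3,4) by (auto simp: dihedral_wreath_def xy)
next
  fix x assume "x \<in> carrier dihedral_wreath"
  then obtain e k h where x: "x = (e, k, h)" "e \<in> {1,-1}" "finite {x. h x \<noteq> 0}"
    by (auto simp: dihedral_wreath_def)
  have "finite {x. - h (e * x + k) \<noteq> 0}"
    using finite_support_affine[OF x(3,2), of "- e * k"] x(2) by (auto simp: algebra_simps)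
  then have "(e, - e * k, \<lambda>x. - h (e * x + k)) \<in> carrier dihedral_wreath"
    using x by (auto simp: dihedral_wreath_def)
  then show "\<exists>y\<in>carrier dihedral_wreath. y \<otimes>\<^bsub>dihedral_wreath\<^esub> x = \<one>\<^bsub>dihedral_wreath\<^esub>"
    by (rule bexI[rotated]) (use x(2) in \<open>auto simp: x dihedral_wreath_def\<close>)
qed (auto simp: dihedral_wreath_def algebra_simps)

text \<open>The generators are indexed by the numerals \<open>0\<close> and \<open>1\<close>, which is the form in which the
  simplification rules on generators mention them.\<close>
declare One_nat_def [simp del]

abbreviation F2 :: "nat word monoid" where "F2 \<equiv> free_group {..<2}"

abbreviation gen_a :: "nat word" where "gen_a \<equiv> gen 0"
abbreviation gen_b :: "nat word" where "gen_b \<equiv> gen 1"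

text \<open>The homomorphism sends \<open>a\<close> to the reflection at \<open>0\<close>, which also raises the lamp at \<open>0\<close> by one, and
  \<open>b\<close> to the unit translation. Its dihedral part alone makes \<open>a\<^sup>2\<close> trivial; the lamps keep track
  of the conjugates \<open>b\<^sup>j a\<^sup>2 b\<^sup>-\<^sup>j\<close>.\<close>
definition rho :: "nat word \<Rightarrow> int \<times> int \<times> (int \<Rightarrow> int)" where
  "rho = (SOME h. h \<in> hom F2 dihedral_wreath \<and>
    h gen_a = (-1, 0, \<lambda>x. if x = 0 then 1 else 0) \<and> h gen_b = (1, 1, \<lambda>_. 0))"

lemma rho: "rho \<in> hom F2 dihedral_wreath"
    "rho gen_a = (-1, 0, \<lambda>x. if x = 0 then 1 else 0)" "rho gen_b = (1, 1, \<lambda>_. 0)"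
proof -
  define f :: "nat \<Rightarrow> int \<times> int \<times> (int \<Rightarrow> int)" where
    "f i = (if i = 0 then (-1, 0, \<lambda>x. if x = 0 then 1 else 0) else (1, 1, \<lambda>_. 0))" for i
  have "f \<in> {..<2} \<rightarrow> carrier dihedral_wreath"
    by (auto simp: f_def dihedral_wreath_def)
  from group.free_group_universal[OF group_dihedral_wreath this]
  have "\<exists>h. h \<in> hom F2 dihedral_wreath \<and>
    h gen_a = (-1, 0, \<lambda>x. if x = 0 then 1 else 0) \<and> h gen_b = (1, 1, \<lambda>_. 0)"
    by (force simp: f_def)
  from someI_ex[OF this, folded rho_def]
  show "rho \<in> hom F2 dihedral_wreath"
    "rho gen_a = (-1, 0, \<lambda>x. if x = 0 then 1 else 0)" "rho gen_b = (1, 1, \<lambda>_. 0)" by auto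
qed

interpretation F2: group F2 by (rule group_free_group)
interpretation rho: group_hom F2 dihedral_wreath rho
  by (simp add: group_hom_def group_hom_axioms_def F2.is_group group_dihedral_wreath rho)

definition sgn_hom :: "nat word \<Rightarrow> int" where "sgn_hom w = fst (rho w)"
definition shift :: "nat word \<Rightarrow> int" where "shift w = fst (snd (rho w))"
definition lamps :: "nat word \<Rightarrow> int \<Rightarrow> int" where "lamps w = snd (snd (rho w))"

lemma gen_F2 [simp]: "gen_a \<in> carrier F2" "gen_b \<in> carrier F2"
  by (auto intro: gen_closed)

lemma rho_gens [simp]:
  "sgn_hom gen_a = -1" "shift gen_a = 0" "lamps gen_a x = (if x = 0 then 1 else 0)"
  "sgn_hom gen_b = 1" "shift gen_b = 1" "lamps gen_b x = 0"
  by (simp_all add: sgn_hom_def shift_def lamps_def rho)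

lemma rho_one [simp]: "sgn_hom \<one>\<^bsub>F2\<^esub> = 1" "shift \<one>\<^bsub>F2\<^esub> = 0" "lamps \<one>\<^bsub>F2\<^esub> x = 0"
  by (simp_all add: sgn_hom_def shift_def lamps_def) (simp_all add: dihedral_wreath_def)

lemma rho_mult:
  assumes "x \<in> carrier F2" "y \<in> carrier F2"
  shows "sgn_hom (x \<otimes>\<^bsub>F2\<^esub> y) = sgn_hom x * sgn_hom y"
    "shift (x \<otimes>\<^bsub>F2\<^esub> y) = shift x + sgn_hom x * shift y"
    "lamps (x \<otimes>\<^bsub>F2\<^esub> y) z = lamps x z + lamps y (sgn_hom x * (z - shift x))"
  using assms by (simp_all add: sgn_hom_def shift_def lamps_def)
    (simp_all add: dihedral_wreath_def split: prod.split)

lemma sgn_hom_cases: "x \<in> carrier F2 \<Longrightarrow> sgn_hom x \<in> {1, -1}"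
  and finite_lamps: "x \<in> carrier F2 \<Longrightarrow> finite {z. lamps x z \<noteq> 0}"
  using rho.hom_closed[of x] by (auto simp: sgn_hom_def lamps_def dihedral_wreath_def)

lemma sgn_hom_square: "x \<in> carrier F2 \<Longrightarrow> sgn_hom x * sgn_hom x = 1"
  using sgn_hom_cases by fastforce

lemma rho_inv:
  assumes x: "x \<in> carrier F2"
  shows "sgn_hom (inv\<^bsub>F2\<^esub> x) = sgn_hom x" "shift (inv\<^bsub>F2\<^esub> x) = - sgn_hom x * shift x"
    "lamps (inv\<^bsub>F2\<^esub> x) z = - lamps x (sgn_hom x * z + shift x)"
proof -
  note m = rho_mult[OF F2.inv_closed[OF x] x]
  show 1: "sgn_hom (inv\<^bsub>F2\<^esub> x) = sgn_hom x"
    using m(1) x sgn_hom_cases[OF x] sgn_hom_cases[OF F2.inv_closed[OF x]] by auto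
  show 2: "shift (inv\<^bsub>F2\<^esub> x) = - sgn_hom x * shift x" using m(2) x 1 by simp
  show "lamps (inv\<^bsub>F2\<^esub> x) z = - lamps x (sgn_hom x * z + shift x)"
    using m(3)[of z] x sgn_hom_square[OF x] by (simp add: 1 2 algebra_simps flip: mult.assoc)
qed

lemma rho_gen_b_pow:
  "sgn_hom (gen_b [^]\<^bsub>F2\<^esub> (j::int)) = 1" "shift (gen_b [^]\<^bsub>F2\<^esub> j) = j"
  "lamps (gen_b [^]\<^bsub>F2\<^esub> j) z = 0"
proof -
  have "\<forall>z. sgn_hom (gen_b [^]\<^bsub>F2\<^esub> j) = 1 \<and> shift (gen_b [^]\<^bsub>F2\<^esub> j) = j \<and> lamps (gen_b [^]\<^bsub>F2\<^esub> j) z = 0"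
  proof (induction j rule: int_induct[where k = 0])
    case (step1 j)
    then show ?case using F2.int_pow_mult[OF gen_F2(2), of j 1] by (simp add: rho_mult)
  next
    case (step2 j)
    then show ?case using F2.int_pow_diff[OF gen_F2(2), of j 1]
      by (simp add: rho_mult rho_inv)
  qed simp
  then show "sgn_hom (gen_b [^]\<^bsub>F2\<^esub> (j::int)) = 1" "shift (gen_b [^]\<^bsub>F2\<^esub> j) = j"
    "lamps (gen_b [^]\<^bsub>F2\<^esub> j) z = 0" by auto
qed

definition sgn_ker :: "nat word set" where
  "sgn_ker = {w \<in> carrier F2. sgn_hom w = 1}"

definition dihedral_ker :: "nat word set" where
  "dihedral_ker = {w \<in> sgn_ker. shift w = 0}"

lemma subgroup_sgn_ker: "subgroup sgn_ker F2"
  by standard (auto simp: sgn_ker_def rho_mult rho_inv)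

lemma subgroup_dihedral_ker: "subgroup dihedral_ker F2"
  by standard (auto simp: dihedral_ker_def sgn_ker_def rho_mult rho_inv)

lemma sgn_ker_finitely_generated:
  "\<exists>S. finite S \<and> S \<subseteq> sgn_ker \<and> generate F2 S = sgn_ker"
proof (rule F2.finite_index_generators[of "gen ` {..<2}"])
  show "finite (rcosets\<^bsub>F2\<^esub> sgn_ker)"
  proof (rule F2.finite_rcosets_if[OF subgroup_sgn_ker, of sgn_hom])
    show "finite (sgn_hom ` carrier F2)"
      by (rule finite_subset[of _ "{1, -1}"]) (use sgn_hom_cases in auto)
  qed (auto simp: sgn_ker_def rho_mult rho_inv sgn_hom_square)
qed (use subgroup_sgn_ker generate_gen in \<open>auto intro: gen_closed\<close>)

text \<open>On the kernel of the dihedral part, \<open>lamps\<close> is additive. So finitely many elements of the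
  kernel can only change the lamps in a finite set of positions, but \<open>b\<^sup>j a\<^sup>2 b\<^sup>-\<^sup>j\<close> puts the value
  \<open>2\<close> at position \<open>j\<close>.\<close>
theorem dihedral_ker_not_finitely_generated:
  "\<not> finitely_generated (F2\<lparr>carrier := dihedral_ker\<rparr>)"
proof
  assume "finitely_generated (F2\<lparr>carrier := dihedral_ker\<rparr>)"
  then obtain A where A: "finite A" "A \<subseteq> dihedral_ker" "generate F2 A = dihedral_ker"
    unfolding F2.finitely_generated_subgroup_iff[OF subgroup_dihedral_ker] by blast
  define S where "S = (\<Union>a\<in>A. {z. lamps a z \<noteq> 0})"
  have D: "x \<in> carrier F2" "sgn_hom x = 1" "shift x = 0" if "x \<in> dihedral_ker" for x
    using that by (auto simp: dihedral_ker_def sgn_ker_def)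
  have AD: "x \<in> dihedral_ker" if "x \<in> A" for x using that A by auto
  have "finite S" unfolding S_def using A D(1)[OF AD] by (auto intro: finite_lamps)
  then obtain j where j: "j \<notin> S" using ex_new_if_finite[OF infinite_UNIV_int] by blast
  have vanish: "lamps x j = 0" if "x \<in> generate F2 A" for x
    using that
  proof (induction rule: generate.induct)
    case (incl x)
    then show ?case using j by (auto simp: S_def)
  next
    case (inv x)
    then show ?case using j D[OF AD[OF inv]] by (auto simp: S_def rho_inv)
  next
    case (eng x y)
    then show ?case using D[of x] D[of y] A(3) by (simp add: rho_mult)
  qed simp
  define y where "y = gen_b [^]\<^bsub>F2\<^esub> j \<otimes>\<^bsub>F2\<^esub> (gen_a \<otimes>\<^bsub>F2\<^esub> (gen_a \<otimes>\<^bsub>F2\<^esub> gen_b [^]\<^bsub>F2\<^esub> (-j)))"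
  have "y \<in> dihedral_ker" "lamps y j = 2"
    by (auto simp: y_def dihedral_ker_def sgn_ker_def rho_mult rho_gen_b_pow)
  then show False using vanish[of y] A(3) by simp
qed

text \<open>The source of invariance. The function \<open>shift\<close> is a crossed homomorphism to the integers twisted by
  \<open>sgn_hom\<close>, and so is its composition with an automorphism that preserves \<open>sgn_hom\<close>. A crossed
  homomorphism \<open>\<kappa>\<close> is determined by its values on the two generators, and comparing these values shows
  \<open>\<kappa> = \<kappa>(b) \<cdot> shift + \<kappa>(a) \<cdot> (1 - sgn_hom) / 2\<close>. The second summand vanishes on the kernel of
  \<open>sgn_hom\<close>. In cohomological terms, the first cohomology of the free group of rank two with these
  twisted coefficients has rank one, so automorphisms can act on it only by a sign.\<close>
lemma shift_automorphism:
  assumes \<theta>: "\<theta> \<in> hom F2 F2" and sgn: "\<And>x. x \<in> carrier F2 \<Longrightarrow> sgn_hom (\<theta> x) = sgn_hom x"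
    and x: "x \<in> sgn_ker"
  shows "shift (\<theta> x) = shift (\<theta> gen_b) * shift x"
proof -
  interpret \<theta>: group_hom F2 F2 \<theta>
    using \<theta> by (simp add: group_hom_def group_hom_axioms_def F2.is_group)
  have gens: "gen ` {..<2} = {gen_a, gen_b}" by (auto simp: lessThan_Suc numeral_2_eq_2 One_nat_def)
  \<comment> \<open>The formula for crossed homomorphisms, multiplied by \<open>2\<close> to avoid a division.\<close>
  have "2 * shift (\<theta> x) = 2 * shift (\<theta> gen_b) * shift x + shift (\<theta> gen_a) * (1 - sgn_hom x)"
    if "x \<in> carrier F2" for x
    using that[folded generate_gen]
  proof (induction rule: generate.induct)
    case one
    then show ?case by simp
  next
    case (incl x)
    then show ?case unfolding gens by auto
  next
    case (inv x)
    then show ?case unfolding gens by (auto simp: rho_inv sgn)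
  next
    case (eng x y)
    then have xy: "x \<in> carrier F2" "y \<in> carrier F2" unfolding generate_gen by auto
    have "2 * shift (\<theta> (x \<otimes>\<^bsub>F2\<^esub> y)) = 2 * shift (\<theta> x) + sgn_hom x * (2 * shift (\<theta> y))"
      using xy by (simp add: rho_mult sgn)
    then show ?case unfolding eng.IH using xy by (simp add: rho_mult algebra_simps)
  qed
  from this[of x] x show ?thesis by (auto simp: sgn_ker_def)
qed

section \<open>Powers of free generators\<close>

lemma foldr_push_append: "reduced (v @ w) \<Longrightarrow> foldr push v w = v @ w"
proof (induction v)
  case (Cons a v)
  then have "foldr push v w = v @ w" using reduced_tl[of a "v @ w"] by auto
  then show ?case using Cons.prems push_reduced by simp
qed simp

lemma reduced_replicate [simp]: "reduced (replicate k a)"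
  unfolding reduced_def by (rule successively_if_sorted_wrt) (simp add: sorted_wrt_iff_nth_less, metis inv_letter_neq)

lemma letter_pow:
  "[a] [^]\<^bsub>free_group X\<^esub> (k::nat) = replicate k a"
proof (induction k)
  case 0
  then show ?case by (simp add: nat_pow_def free_group_def)
next
  case (Suc k)
  have "foldr push (replicate k a) [a] = replicate k a @ [a]"
    using reduced_replicate[of "Suc k" a] by (intro foldr_push_append) (simp add: replicate_append_same)
  then show ?case
    using Suc by (simp add: nat_pow_def free_group_def replicate_append_same)
qed

definition blow_up :: "nat \<Rightarrow> 'a word \<Rightarrow> 'a word" where
  "blow_up k w = concat (map (replicate k) w)"

lemma reduced_blow_up:
  assumes k: "k > 0" and w: "reduced w" shows "reduced (blow_up k w)"
  using w
proof (induction w)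
  case (Cons a w)
  have hd: "hd (blow_up k w) = hd w" if "w \<noteq> []"
    using that k by (cases w; cases k) (auto simp: blow_up_def)
  have "w \<noteq> [] \<Longrightarrow> hd w \<noteq> inv_letter a" using Cons.prems by (cases w) (auto simp: reduced_def)
  moreover have "reduced (blow_up k w)" using Cons reduced_tl[of a w] by auto
  ultimately show ?case
    using k hd reduced_replicate[of k a] by (cases "w = []")
      (auto simp: blow_up_def reduced_def successively_append_iff)
qed (simp add: blow_up_def)

text \<open>Replacing every letter of a reduced word by \<open>k\<close> copies of it gives a reduced word. So the
  homomorphism that sends each generator to its \<open>k\<close>-th power is computed without any cancellation.\<close>
theorem free_group_power_embedding:
  assumes XY: "X \<subseteq> Y" and k: "k > 0"
  shows "\<exists>h \<in> hom (free_group X) (free_group Y). inj_on h (carrier (free_group X)) \<and>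
    (\<forall>x\<in>X. h (gen x) = gen x [^]\<^bsub>free_group Y\<^esub> (k::nat))"
proof -
  interpret X: group "free_group X" by (rule group_free_group)
  interpret Y: group "free_group Y" by (rule group_free_group)
  have "(\<lambda>x. gen x [^]\<^bsub>free_group Y\<^esub> k) \<in> X \<rightarrow> carrier (free_group Y)"
    using XY by (auto intro!: Y.nat_pow_closed gen_closed)
  from Y.free_group_universal[OF this] obtain h where
    h: "h \<in> hom (free_group X) (free_group Y)" "\<And>x. x \<in> X \<Longrightarrow> h (gen x) = gen x [^]\<^bsub>free_group Y\<^esub> k"
    by blast
  interpret h: group_hom "free_group X" "free_group Y" h
    using h(1) by (simp add: group_hom_def group_hom_axioms_def X.is_group Y.is_group)
  have letter: "h [(x, e)] = replicate k (x, e)" if "x \<in> X" for x e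
  proof (cases e)
    case True
    then show ?thesis using h(2)[OF that] letter_pow[where X = Y and a = "(x, True)" and k = k] by (simp add: gen_def)
  next
    case False
    have xy: "gen x \<in> carrier (free_group X)" "gen x \<in> carrier (free_group Y)"
      using that XY by (auto intro: gen_closed)
    have "h [(x, False)] = inv\<^bsub>free_group Y\<^esub> (gen x [^]\<^bsub>free_group Y\<^esub> k)"
      using h.hom_inv[OF xy(1)] inv_gen[OF that] h(2)[OF that] by simp
    also have "\<dots> = (inv\<^bsub>free_group Y\<^esub> gen x) [^]\<^bsub>free_group Y\<^esub> k"
      using xy by (simp add: Y.nat_pow_inv)
    also have "\<dots> = replicate k (x, False)"
      using that XY inv_gen[of x Y] letter_pow[where X = Y and a = "(x, False)" and k = k] by auto
    finally show ?thesis using False by simp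
  qed
  have blow: "h w = blow_up k w" if "w \<in> carrier (free_group X)" for w
    using that
  proof (induction w)
    case Nil
    then show ?case using h.hom_one by (simp add: blow_up_def free_group_def)
  next
    case (Cons a w)
    have w: "w \<in> carrier (free_group X)" and a: "[a] \<in> carrier (free_group X)"
      and red: "reduced (a # w)"
      using Cons.prems by (auto simp: free_group_def dest: reduced_tl) (simp add: reduced_def)
    have "a # w = [a] \<otimes>\<^bsub>free_group X\<^esub> w" using push_reduced[OF red] by (simp add: free_group_def)
    then have "h (a # w) = h [a] \<otimes>\<^bsub>free_group Y\<^esub> h w" using h.hom_mult[OF a w] by simp
    also have "h [a] = replicate k a" using letter[of "fst a" "snd a"] a by (auto simp: free_group_def)
    also have "replicate k a \<otimes>\<^bsub>free_group Y\<^esub> h w = replicate k a @ blow_up k w"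
      unfolding Cons.IH[OF w] using foldr_push_append[of "replicate k a" "blow_up k w"]
        reduced_blow_up[OF k red] by (simp add: free_group_def blow_up_def)
    finally show ?case by (simp add: blow_up_def)
  qed
  have "w = []" if "w \<in> carrier (free_group X)" "h w = \<one>\<^bsub>free_group Y\<^esub>" for w
    using that blow[OF that(1)] k by (cases w) (auto simp: blow_up_def free_group_def)
  then have "inj_on h (carrier (free_group X))"
    by (simp add: h.inj_on_one_iff) (auto simp: free_group_def)
  then show ?thesis using h by blast
qed

section \<open>Free-by-free groups with fibre of rank two\<close>

locale F2_by_free =
  fixes n :: nat and \<phi> :: "nat word \<Rightarrow> nat word \<Rightarrow> nat word"
  assumes n: "n \<ge> 2"
    and \<phi>: "\<phi> \<in> hom (free_group {..<n}) (AutoGroup F2)"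
begin

abbreviation Fn :: "nat word monoid" where "Fn \<equiv> free_group {..<n}"
abbreviation G :: "(nat word \<times> nat word) monoid" where "G \<equiv> semidirect F2 \<phi> Fn"

sublocale Fn: group Fn by (rule group_free_group)
sublocale G: group G by (rule group_semidirect[OF group_free_group group_free_group \<phi>])

lemma action_hom: "q \<in> carrier Fn \<Longrightarrow> \<phi> q \<in> hom F2 F2"
  using hom_in_carrier[OF \<phi>] by (auto simp: AutoGroup_def auto_def)

lemma action_closed: "q \<in> carrier Fn \<Longrightarrow> x \<in> carrier F2 \<Longrightarrow> \<phi> q x \<in> carrier F2"
  using action_hom by (rule hom_in_carrier)

lemma action_mult: "q \<in> carrier Fn \<Longrightarrow> x \<in> carrier F2 \<Longrightarrow> y \<in> carrier F2 \<Longrightarrow>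
    \<phi> q (x \<otimes>\<^bsub>F2\<^esub> y) = \<phi> q x \<otimes>\<^bsub>F2\<^esub> \<phi> q y"
  using action_hom by (rule hom_mult)

lemma action_comp:
  assumes "p \<in> carrier Fn" "q \<in> carrier Fn" "x \<in> carrier F2"
  shows "\<phi> (p \<otimes>\<^bsub>Fn\<^esub> q) x = \<phi> p (\<phi> q x)"
  using hom_mult[OF \<phi> assms(1,2)] hom_in_carrier[OF \<phi> assms(1)] hom_in_carrier[OF \<phi> assms(2)] assms(3)
  by (simp add: AutoGroup_def auto_def BijGroup_def compose_def)

lemma action_one:
  assumes x: "x \<in> carrier F2"
  shows "\<phi> \<one>\<^bsub>Fn\<^esub> x = x"
proof -
  have "\<phi> \<one>\<^bsub>Fn\<^esub> (\<phi> \<one>\<^bsub>Fn\<^esub> x) = \<phi> \<one>\<^bsub>Fn\<^esub> x" using action_comp[of "\<one>\<^bsub>Fn\<^esub>" "\<one>\<^bsub>Fn\<^esub>" x] x by simp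
  moreover have "inj_on (\<phi> \<one>\<^bsub>Fn\<^esub>) (carrier F2)"
    using hom_in_carrier[OF \<phi> Fn.one_closed] by (auto simp: AutoGroup_def auto_def Bij_def bij_betw_def)
  ultimately show ?thesis using x action_closed[of "\<one>\<^bsub>Fn\<^esub>" x] by (meson Fn.one_closed inj_onD)
qed

lemma action_one_right: "q \<in> carrier Fn \<Longrightarrow> \<phi> q \<one>\<^bsub>F2\<^esub> = \<one>\<^bsub>F2\<^esub>"
  by (rule hom_one[OF action_hom F2.is_group F2.is_group])

lemma action_inv:
  assumes "q \<in> carrier Fn" "x \<in> carrier F2"
  shows "\<phi> (inv\<^bsub>Fn\<^esub> q) (\<phi> q x) = x" "\<phi> q (\<phi> (inv\<^bsub>Fn\<^esub> q) x) = x"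
  using assms by (simp_all add: action_one flip: action_comp)

lemma carrier_G: "carrier G = carrier F2 \<times> carrier Fn" by (simp add: semidirect_def)

lemma mult_G: "(x, p) \<otimes>\<^bsub>G\<^esub> (y, q) = (x \<otimes>\<^bsub>F2\<^esub> \<phi> p y, p \<otimes>\<^bsub>Fn\<^esub> q)"
  by (simp add: semidirect_def)

lemma one_G: "\<one>\<^bsub>G\<^esub> = (\<one>\<^bsub>F2\<^esub>, \<one>\<^bsub>Fn\<^esub>)" by (simp add: semidirect_def)

lemma inv_G:
  assumes "x \<in> carrier F2" "q \<in> carrier Fn"
  shows "inv\<^bsub>G\<^esub> (x, q) = (\<phi> (inv\<^bsub>Fn\<^esub> q) (inv\<^bsub>F2\<^esub> x), inv\<^bsub>Fn\<^esub> q)"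
  using assms
  by (intro G.inv_equality)
    (auto simp: carrier_G mult_G one_G action_closed action_one_right simp flip: action_mult)

text \<open>The elements of \<open>F\<^sub>n\<close> whose action preserves the character \<open>sgn_hom\<close>, and among them those that also
  preserve the restriction of \<open>shift\<close> to \<open>sgn_ker\<close>.\<close>
definition sgn_stab :: "nat word set" where
  "sgn_stab = {q \<in> carrier Fn. \<forall>x\<in>carrier F2. sgn_hom (\<phi> q x) = sgn_hom x}"

definition shift_stab :: "nat word set" where
  "shift_stab = {q \<in> sgn_stab. \<forall>x\<in>sgn_ker. shift (\<phi> q x) = shift x}"

lemma sgn_stab_subgroup: "subgroup sgn_stab Fn"
proof
  fix q assume "q \<in> sgn_stab"
  then have q: "q \<in> carrier Fn" "\<And>x. x \<in> carrier F2 \<Longrightarrow> sgn_hom (\<phi> q x) = sgn_hom x"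
    by (auto simp: sgn_stab_def)
  have "sgn_hom (\<phi> (inv\<^bsub>Fn\<^esub> q) x) = sgn_hom x" if "x \<in> carrier F2" for x
    using q(2)[of "\<phi> (inv\<^bsub>Fn\<^esub> q) x"] q(1) that by (simp add: action_closed action_inv)
  then show "inv\<^bsub>Fn\<^esub> q \<in> sgn_stab" using q(1) by (auto simp: sgn_stab_def)
qed (auto simp: sgn_stab_def action_comp action_closed action_one)

lemma sgn_stab_ker: "q \<in> sgn_stab \<Longrightarrow> x \<in> sgn_ker \<Longrightarrow> \<phi> q x \<in> sgn_ker"
  by (auto simp: sgn_stab_def sgn_ker_def action_closed)

lemma shift_stab_subgroup: "subgroup shift_stab Fn"
proof
  note S = sgn_stab_subgroup
  show "shift_stab \<subseteq> carrier Fn" by (auto simp: shift_stab_def sgn_stab_def)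
  show "\<one>\<^bsub>Fn\<^esub> \<in> shift_stab"
    using subgroup.one_closed[OF S] by (auto simp: shift_stab_def sgn_ker_def action_one)
  fix q assume "q \<in> shift_stab"
  then have q: "q \<in> sgn_stab" "q \<in> carrier Fn" "\<And>x. x \<in> sgn_ker \<Longrightarrow> shift (\<phi> q x) = shift x"
    by (auto simp: shift_stab_def sgn_stab_def)
  have qi: "inv\<^bsub>Fn\<^esub> q \<in> sgn_stab" using subgroup.m_inv_closed[OF S q(1)] .
  have "shift (\<phi> (inv\<^bsub>Fn\<^esub> q) x) = shift x" if "x \<in> sgn_ker" for x
    using q(3)[OF sgn_stab_ker[OF qi that]] q(2) that by (simp add: action_inv sgn_ker_def)
  then show "inv\<^bsub>Fn\<^esub> q \<in> shift_stab" using qi by (auto simp: shift_stab_def)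
  fix p assume "p \<in> shift_stab"
  then have p: "p \<in> sgn_stab" "p \<in> carrier Fn" "\<And>x. x \<in> sgn_ker \<Longrightarrow> shift (\<phi> p x) = shift x"
    by (auto simp: shift_stab_def sgn_stab_def)
  have "shift (\<phi> (q \<otimes>\<^bsub>Fn\<^esub> p) x) = shift x" if "x \<in> sgn_ker" for x
    using that q p sgn_stab_ker[OF p(1) that] by (simp add: action_comp sgn_ker_def)
  then show "q \<otimes>\<^bsub>Fn\<^esub> p \<in> shift_stab"
    using subgroup.m_closed[OF S q(1) p(1)] by (auto simp: shift_stab_def)
qed

lemma gen_b_ker: "gen_b \<in> sgn_ker" by (simp add: sgn_ker_def)

lemma shift_action:
  assumes "q \<in> sgn_stab" "x \<in> sgn_ker"
  shows "shift (\<phi> q x) = shift (\<phi> q gen_b) * shift x"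
  using assms by (intro shift_automorphism action_hom) (auto simp: sgn_stab_def)

lemma shift_action_gen_b_mult:
  assumes "p \<in> sgn_stab" "q \<in> sgn_stab"
  shows "shift (\<phi> (p \<otimes>\<^bsub>Fn\<^esub> q) gen_b) = shift (\<phi> p gen_b) * shift (\<phi> q gen_b)"
  using shift_action[OF assms(1) sgn_stab_ker[OF assms(2) gen_b_ker]] assms
  by (simp add: sgn_stab_def action_comp)

text \<open>An element of the stabiliser multiplies \<open>shift\<close> on \<open>sgn_ker\<close> by an integer. Its inverse does
  so by an integer, too, and the product of the two integers is \<open>1\<close>.\<close>
lemma shift_action_gen_b_unit:
  assumes q: "q \<in> sgn_stab"
  shows "shift (\<phi> q gen_b) \<in> {1, -1}" "shift (\<phi> (inv\<^bsub>Fn\<^esub> q) gen_b) = shift (\<phi> q gen_b)"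
proof -
  have qc: "q \<in> carrier Fn" using q by (simp add: sgn_stab_def)
  have "shift (\<phi> q gen_b) * shift (\<phi> (inv\<^bsub>Fn\<^esub> q) gen_b) = 1"
    using shift_action_gen_b_mult[OF q subgroup.m_inv_closed[OF sgn_stab_subgroup q]] qc
    by (simp add: action_one)
  then have "shift (\<phi> q gen_b) = 1 \<and> shift (\<phi> (inv\<^bsub>Fn\<^esub> q) gen_b) = 1 \<or>
      shift (\<phi> q gen_b) = -1 \<and> shift (\<phi> (inv\<^bsub>Fn\<^esub> q) gen_b) = -1"
    by (simp only: zmult_eq_1_iff)
  then show "shift (\<phi> q gen_b) \<in> {1, -1}" "shift (\<phi> (inv\<^bsub>Fn\<^esub> q) gen_b) = shift (\<phi> q gen_b)"
    by auto
qed

lemma sgn_stab_if: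
  assumes p: "p \<in> carrier Fn" and q: "q \<in> carrier Fn"
    and a: "sgn_hom (\<phi> p gen_a) = sgn_hom (\<phi> q gen_a)"
    and b: "sgn_hom (\<phi> p gen_b) = sgn_hom (\<phi> q gen_b)"
  shows "p \<otimes>\<^bsub>Fn\<^esub> inv\<^bsub>Fn\<^esub> q \<in> sgn_stab"
proof -
  have gens: "gen ` {..<2} = {gen_a, gen_b}" by (auto simp: lessThan_Suc numeral_2_eq_2 One_nat_def)
  have "sgn_hom (\<phi> p x) = sgn_hom (\<phi> q x)" if "x \<in> carrier F2" for x
    using that[folded generate_gen]
  proof (induction rule: generate.induct)
    case one
    then show ?case using p q by (simp add: action_one_right)
  next
    case (incl x)
    then show ?case using a b unfolding gens by auto
  next
    case (inv x)
    have i: "\<phi> r (inv\<^bsub>F2\<^esub> y) = inv\<^bsub>F2\<^esub> (\<phi> r y)" if "r \<in> carrier Fn" "y \<in> carrier F2" for r y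
      using that action_hom[OF that(1)] group_hom.hom_inv[of F2 F2 "\<phi> r" y]
      by (simp add: group_hom_def group_hom_axioms_def F2.is_group)
    show ?case using inv p q a b unfolding gens by (auto simp: i rho_inv action_closed)
  next
    case (eng x y)
    then have "x \<in> carrier F2" "y \<in> carrier F2" unfolding generate_gen by auto
    then show ?case using eng.IH p q by (simp add: action_mult rho_mult action_closed)
  qed
  from this[of "\<phi> (inv\<^bsub>Fn\<^esub> q) _"] show ?thesis
    using p q by (auto simp: sgn_stab_def action_comp action_closed action_inv)
qed

text \<open>A character of \<open>F\<^sub>2\<close> with values \<open>\<plusminus>1\<close> has at most four images under automorphisms, so the
  stabiliser of \<open>sgn_hom\<close> has finite index; the sign by which it acts on \<open>shift\<close> costs
  at most a further factor of two. The invariant \<open>e\<close> reads off that sign after translating an element into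
  the stabiliser by a fixed representative of its class.\<close>
lemma shift_stab_finite_index: "finite (rcosets\<^bsub>Fn\<^esub> shift_stab)"
proof -
  define c where "c q = (sgn_hom (\<phi> q gen_a), sgn_hom (\<phi> q gen_b))" for q
  define r where "r q = inv_into (carrier Fn) c (c q)" for q
  define e where "e q = shift (\<phi> (q \<otimes>\<^bsub>Fn\<^esub> inv\<^bsub>Fn\<^esub> r q) gen_b)" for q
  have r: "r q \<in> carrier Fn" "c (r q) = c q" if "q \<in> carrier Fn" for q
    unfolding r_def using that by (simp_all only: inv_into_into f_inv_into_f imageI)
  have s: "q \<otimes>\<^bsub>Fn\<^esub> inv\<^bsub>Fn\<^esub> r q \<in> sgn_stab" if "q \<in> carrier Fn" for q
    using sgn_stab_if[OF that r(1)[OF that]] r(2)[OF that] by (simp only: c_def prod.inject)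
  show ?thesis
  proof (rule Fn.finite_rcosets_if[OF shift_stab_subgroup, where v = "\<lambda>q. (c q, e q)"])
    have "(\<lambda>q. (c q, e q)) ` carrier Fn \<subseteq> ({1, -1} \<times> {1, -1}) \<times> {1, -1}"
    proof
      fix z assume "z \<in> (\<lambda>q. (c q, e q)) ` carrier Fn"
      then obtain q where q: "q \<in> carrier Fn" "z = (c q, e q)" by blast
      have "e q \<in> {1, -1}" unfolding e_def by (rule shift_action_gen_b_unit(1)[OF s[OF q(1)]])
      moreover have "c q \<in> {1, -1} \<times> {1, -1}"
        unfolding c_def using sgn_hom_cases[OF action_closed[OF q(1)]] by (intro SigmaI) simp_all
      ultimately show "z \<in> ({1, -1} \<times> {1, -1}) \<times> {1, -1}" unfolding q(2) by (rule SigmaI[rotated])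
    qed
    then show "finite ((\<lambda>q. (c q, e q)) ` carrier Fn)" by (rule finite_subset) auto
  next
    fix p q assume pq: "p \<in> carrier Fn" "q \<in> carrier Fn" and eq: "(c p, e p) = (c q, e q)"
    then have rr: "r p = r q" by (simp add: r_def)
    let ?p = "p \<otimes>\<^bsub>Fn\<^esub> inv\<^bsub>Fn\<^esub> r q" and ?q = "q \<otimes>\<^bsub>Fn\<^esub> inv\<^bsub>Fn\<^esub> r q"
    have st: "?p \<in> sgn_stab" "?q \<in> sgn_stab" using s[OF pq(1)] s[OF pq(2)] rr by auto
    have prod: "p \<otimes>\<^bsub>Fn\<^esub> inv\<^bsub>Fn\<^esub> q = ?p \<otimes>\<^bsub>Fn\<^esub> inv\<^bsub>Fn\<^esub> ?q"
      using pq r[OF pq(2)] by (simp add: Fn.inv_mult_group Fn.m_assoc)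
    have mem: "p \<otimes>\<^bsub>Fn\<^esub> inv\<^bsub>Fn\<^esub> q \<in> sgn_stab"
      unfolding prod using sgn_stab_subgroup st(1) subgroup.m_inv_closed[OF sgn_stab_subgroup st(2)]
      by (rule subgroup.m_closed)
    have "shift (\<phi> (p \<otimes>\<^bsub>Fn\<^esub> inv\<^bsub>Fn\<^esub> q) gen_b) = shift (\<phi> ?p gen_b) * shift (\<phi> ?q gen_b)"
      unfolding prod using st shift_action_gen_b_unit(2)[OF st(2)]
        subgroup.m_inv_closed[OF sgn_stab_subgroup st(2)] by (simp add: shift_action_gen_b_mult)
    also have "\<dots> = 1" using eq rr shift_action_gen_b_unit(1)[OF st(2)] by (auto simp: e_def)
    finally show "p \<otimes>\<^bsub>Fn\<^esub> inv\<^bsub>Fn\<^esub> q \<in> shift_stab"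
      using mem shift_action[OF mem] by (auto simp: shift_stab_def)
  qed
qed

text \<open>These are the subgroups \<open>sgn_ker \<rtimes> Q\<close> of \<open>F\<^sub>2 \<rtimes> F\<^sub>n\<close>, for \<open>Q\<close> a group of elements that preserve
  \<open>shift\<close>. On them \<open>shift\<close> of the first component is a character that does not vanish on the
  normal subgroup \<open>sgn_ker\<close>.\<close>
definition sgn_ker_by :: "nat word set \<Rightarrow> (nat word \<times> nat word) set" where
  "sgn_ker_by Q = sgn_ker \<times> Q"

definition base :: "nat word set \<Rightarrow> (nat word \<times> nat word) set" where
  "base X = (\<lambda>x. (x, \<one>\<^bsub>Fn\<^esub>)) ` X"

lemma base_hom: "group_hom F2 G (\<lambda>x. (x, \<one>\<^bsub>Fn\<^esub>))"
  by (intro group_hom.intro F2.is_group G.is_group group_hom_axioms.intro homI)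
    (simp_all add: carrier_G mult_G action_one)

lemma section_hom: "group_hom Fn G (\<lambda>q. (\<one>\<^bsub>F2\<^esub>, q))"
  by (intro group_hom.intro Fn.is_group G.is_group group_hom_axioms.intro homI)
    (simp_all add: carrier_G mult_G action_one_right)

lemma generate_base: "X \<subseteq> carrier F2 \<Longrightarrow> generate G (base X) = base (generate F2 X)"
  unfolding base_def by (rule group_hom.generate_img[OF base_hom])

lemma shift_stabD:
  assumes "q \<in> shift_stab"
  shows "q \<in> carrier Fn" "x \<in> carrier F2 \<Longrightarrow> sgn_hom (\<phi> q x) = sgn_hom x"
    "x \<in> sgn_ker \<Longrightarrow> shift (\<phi> q x) = shift x" "x \<in> sgn_ker \<Longrightarrow> \<phi> q x \<in> sgn_ker"
  using assms sgn_stab_ker by (auto simp: shift_stab_def sgn_stab_def)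

context
  fixes Q :: "nat word set"
  assumes Q: "subgroup Q Fn" "Q \<subseteq> shift_stab"
begin

lemma QD: "q \<in> Q \<Longrightarrow> q \<in> carrier Fn" "q \<in> Q \<Longrightarrow> q \<in> shift_stab" "\<one>\<^bsub>Fn\<^esub> \<in> Q"
  using Q by (auto simp: subgroup.one_closed subgroup.mem_carrier)

lemma sgn_ker_by_subgroup: "subgroup (sgn_ker_by Q) G"
proof
  show "sgn_ker_by Q \<subseteq> carrier G" using QD by (auto simp: sgn_ker_by_def carrier_G sgn_ker_def)
  show "\<one>\<^bsub>G\<^esub> \<in> sgn_ker_by Q" using QD by (auto simp: sgn_ker_by_def one_G sgn_ker_def)
  fix z assume "z \<in> sgn_ker_by Q"
  then obtain x q where z: "z = (x, q)" "x \<in> sgn_ker" "q \<in> Q" by (auto simp: sgn_ker_by_def)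
  have "inv\<^bsub>Fn\<^esub> q \<in> Q" "inv\<^bsub>F2\<^esub> x \<in> sgn_ker"
    using z Q(1) subgroup_sgn_ker by (auto intro: subgroup.m_inv_closed)
  then show "inv\<^bsub>G\<^esub> z \<in> sgn_ker_by Q"
    using z QD shift_stabD(4) by (simp add: sgn_ker_by_def inv_G sgn_ker_def)
  fix w assume "w \<in> sgn_ker_by Q"
  then obtain y r where w: "w = (y, r)" "y \<in> sgn_ker" "r \<in> Q" by (auto simp: sgn_ker_by_def)
  have "\<phi> q y \<in> sgn_ker" using w z QD shift_stabD(4) by blast
  then show "z \<otimes>\<^bsub>G\<^esub> w \<in> sgn_ker_by Q"
    using z w Q(1) subgroup_sgn_ker by (auto simp: sgn_ker_by_def mult_G intro: subgroup.m_closed)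
qed

abbreviation "A \<equiv> G\<lparr>carrier := sgn_ker_by Q\<rparr>"

lemma sgn_ker_by_group: "group A"
  by (rule G.subgroup_imp_group[OF sgn_ker_by_subgroup])

lemma shift_hom: "(\<lambda>z. shift (fst z)) \<in> hom A integer_group"
proof (rule homI)
  fix z w assume "z \<in> carrier A" "w \<in> carrier A"
  then show "shift (fst (z \<otimes>\<^bsub>A\<^esub> w)) = shift (fst z) \<otimes>\<^bsub>integer_group\<^esub> shift (fst w)"
    using QD(2) shift_stabD(1,3,4)
    by (auto simp: sgn_ker_by_def mult_G rho_mult sgn_ker_def action_closed)
qed simp

lemma snd_hom:
  assumes "h \<in> hom Fn K"
  shows "(\<lambda>z. h (snd z)) \<in> hom A K"
  using assms QD by (auto simp: hom_def sgn_ker_by_def mult_G Pi_iff)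

lemma base_generated:
  assumes "S \<subseteq> sgn_ker"
  shows "base S \<subseteq> sgn_ker_by Q" "generate A (base S) = base (generate F2 S)"
proof -
  show *: "base S \<subseteq> sgn_ker_by Q" using assms QD by (auto simp: base_def sgn_ker_by_def)
  show "generate A (base S) = base (generate F2 S)"
    unfolding G.generate_consistent[OF * sgn_ker_by_subgroup] 
    using assms by (intro generate_base) (auto simp: sgn_ker_def)
qed

lemma base_not_finitely_generated:
  "\<not> finitely_generated (A\<lparr>carrier := {z \<in> base sgn_ker. shift (fst z) = 0}\<rparr>)"
proof
  have eq: "{z \<in> base sgn_ker. shift (fst z) = 0} = base dihedral_ker"
    by (auto simp: base_def dihedral_ker_def)
  have Mc: "dihedral_ker \<subseteq> carrier F2" by (auto simp: dihedral_ker_def sgn_ker_def)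
  have sub: "subgroup (base dihedral_ker) G"
    unfolding base_def by (rule group_hom.subgroup_img_is_subgroup[OF base_hom subgroup_dihedral_ker])
  assume "finitely_generated (A\<lparr>carrier := {z \<in> base sgn_ker. shift (fst z) = 0}\<rparr>)"
  then have "finitely_generated (G\<lparr>carrier := base dihedral_ker\<rparr>)" unfolding eq by simp
  then obtain S where S: "finite S" "S \<subseteq> base dihedral_ker" "generate G S = base dihedral_ker"
    unfolding G.finitely_generated_subgroup_iff[OF sub] by blast
  define S0 where "S0 = fst ` S"
  have S0: "finite S0" "S0 \<subseteq> dihedral_ker" "S = base S0"
    using S(1,2) by (auto simp: S0_def base_def image_iff) force+
  have "base (generate F2 S0) = base dihedral_ker"
    using S(3) S0 Mc by (simp add: generate_base)
  then have "generate F2 S0 = dihedral_ker"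
    by (simp add: base_def inj_image_eq_iff inj_on_def)
  then show False
    using dihedral_ker_not_finitely_generated S0
    unfolding F2.finitely_generated_subgroup_iff[OF subgroup_dihedral_ker] by blast
qed

lemma sgn_ker_by_generated:
  assumes T: "T \<subseteq> Q" "generate Fn T = Q"
  shows "generate A (base sgn_ker \<union> (\<lambda>q. (\<one>\<^bsub>F2\<^esub>, q)) ` T) = carrier A"
proof -
  let ?X = "base sgn_ker \<union> (\<lambda>q. (\<one>\<^bsub>F2\<^esub>, q)) ` T"
  have X: "?X \<subseteq> sgn_ker_by Q" using T QD by (auto simp: base_def sgn_ker_by_def sgn_ker_def)
  have Tc: "T \<subseteq> carrier Fn" using T QD by auto
  have "sgn_ker_by Q \<subseteq> generate G ?X"
  proof
    fix z assume "z \<in> sgn_ker_by Q"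
    then obtain x q where z: "z = (x, q)" "x \<in> sgn_ker" "q \<in> Q" by (auto simp: sgn_ker_by_def)
    have "(\<one>\<^bsub>F2\<^esub>, q) \<in> (\<lambda>q. (\<one>\<^bsub>F2\<^esub>, q)) ` generate Fn T" using z T by auto
    also have "\<dots> = generate G ((\<lambda>q. (\<one>\<^bsub>F2\<^esub>, q)) ` T)"
      by (rule group_hom.generate_img[OF section_hom Tc, symmetric])
    also have "\<dots> \<subseteq> generate G ?X" by (intro G.mono_generate) auto
    finally have "(\<one>\<^bsub>F2\<^esub>, q) \<in> generate G ?X" .
    moreover have "(x, \<one>\<^bsub>Fn\<^esub>) \<in> generate G ?X" using z by (intro generate.incl) (auto simp: base_def)
    ultimately have "(x, \<one>\<^bsub>Fn\<^esub>) \<otimes>\<^bsub>G\<^esub> (\<one>\<^bsub>F2\<^esub>, q) \<in> generate G ?X" by (rule generate.eng[rotated])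
    then show "z \<in> generate G ?X" using z QD by (simp add: mult_G action_one sgn_ker_def)
  qed
  then show ?thesis
    using G.generate_consistent[OF X sgn_ker_by_subgroup] G.generate_subgroup_incl[OF X sgn_ker_by_subgroup] by auto
qed

lemma base_normal: "base sgn_ker \<lhd> A"
proof -
  interpret A: group A by (rule sgn_ker_by_group)
  have "group_hom A Fn snd"
    by (intro group_hom.intro A.is_group Fn.is_group group_hom_axioms.intro)
      (use snd_hom[of "\<lambda>x. x" Fn] in \<open>auto simp: hom_def\<close>)
  from group_hom.normal_kernel[OF this] have "kernel A Fn snd \<lhd> A" .
  moreover have "kernel A Fn snd = base sgn_ker"
    using QD by (auto simp: kernel_def base_def sgn_ker_by_def)
  ultimately show ?thesis by simp
qed

end

lemma sgn_ker_by_finite_index: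
  assumes Q: "subgroup Q Fn" "Q \<subseteq> shift_stab" "finite (rcosets\<^bsub>Fn\<^esub> Q)"
  shows "finite (rcosets\<^bsub>G\<^esub> sgn_ker_by Q)"
proof (rule G.finite_rcosets_if[OF sgn_ker_by_subgroup[OF Q(1,2)],
      where v = "\<lambda>z. (sgn_hom (fst z), Q #>\<^bsub>Fn\<^esub> snd z)"])
  have Qc: "Q \<subseteq> carrier Fn" using Q(1) by (rule subgroup.subset)
  have "(\<lambda>z. (sgn_hom (fst z), Q #>\<^bsub>Fn\<^esub> snd z)) ` carrier G \<subseteq> {1, -1} \<times> (rcosets\<^bsub>Fn\<^esub> Q)"
  proof
    fix w assume "w \<in> (\<lambda>z. (sgn_hom (fst z), Q #>\<^bsub>Fn\<^esub> snd z)) ` carrier G"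
    then obtain x q where "x \<in> carrier F2" "q \<in> carrier Fn" "w = (sgn_hom x, Q #>\<^bsub>Fn\<^esub> q)"
      by (auto simp: carrier_G)
    then show "w \<in> {1, -1} \<times> (rcosets\<^bsub>Fn\<^esub> Q)"
      using sgn_hom_cases Fn.rcosetsI[OF Qc] by simp
  qed
  then show "finite ((\<lambda>z. (sgn_hom (fst z), Q #>\<^bsub>Fn\<^esub> snd z)) ` carrier G)"
    by (rule finite_subset) (use Q(3) in auto)
  fix z w assume "z \<in> carrier G" "w \<in> carrier G"
    and eq: "(sgn_hom (fst z), Q #>\<^bsub>Fn\<^esub> snd z) = (sgn_hom (fst w), Q #>\<^bsub>Fn\<^esub> snd w)"
  then obtain x q y r where zw: "z = (x, q)" "w = (y, r)" "x \<in> carrier F2" "y \<in> carrier F2"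
    "q \<in> carrier Fn" "r \<in> carrier Fn" by (auto simp: carrier_G)
  have qr: "q \<otimes>\<^bsub>Fn\<^esub> inv\<^bsub>Fn\<^esub> r \<in> Q"
    using eq zw Fn.coset_mult_inv2[of Q q r] Fn.coset_join1[OF _ _ Q(1)] Qc by simp
  have "z \<otimes>\<^bsub>G\<^esub> inv\<^bsub>G\<^esub> w =
      (x \<otimes>\<^bsub>F2\<^esub> \<phi> (q \<otimes>\<^bsub>Fn\<^esub> inv\<^bsub>Fn\<^esub> r) (inv\<^bsub>F2\<^esub> y), q \<otimes>\<^bsub>Fn\<^esub> inv\<^bsub>Fn\<^esub> r)"
    using zw by (simp add: inv_G mult_G action_comp)
  moreover have "sgn_hom (x \<otimes>\<^bsub>F2\<^esub> \<phi> (q \<otimes>\<^bsub>Fn\<^esub> inv\<^bsub>Fn\<^esub> r) (inv\<^bsub>F2\<^esub> y)) = 1"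
    using zw eq shift_stabD(1,2) qr Q(2) sgn_hom_square[OF zw(4)]
    by (simp add: rho_mult rho_inv action_closed subset_iff)
  ultimately show "z \<otimes>\<^bsub>G\<^esub> inv\<^bsub>G\<^esub> w \<in> sgn_ker_by Q"
    using zw qr by (simp add: sgn_ker_by_def sgn_ker_def action_closed)
qed

definition expsum :: "nat word \<Rightarrow> int" where
  "expsum = (SOME h. h \<in> hom Fn integer_group \<and> (\<forall>i<n. h (gen i) = 1))"

lemma expsum: "expsum \<in> hom Fn integer_group" "i < n \<Longrightarrow> expsum (gen i) = 1"
proof -
  have "\<exists>h. h \<in> hom Fn integer_group \<and> (\<forall>i<n. h (gen i) = 1)"
    using group.free_group_universal[OF group_integer_group, of "\<lambda>_. 1" "{..<n}"] by auto
  from someI_ex[OF this, folded expsum_def]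
  show "expsum \<in> hom Fn integer_group" "i < n \<Longrightarrow> expsum (gen i) = 1" by auto
qed

lemma expsum_pow: "i < n \<Longrightarrow> expsum (gen i [^]\<^bsub>Fn\<^esub> (k::nat)) = int k"
  using Fn.hom_integer_group(4)[OF expsum(1) gen_closed, of i "int k"]
  by (simp add: int_pow_int expsum)

lemma gen_n: "gen 0 \<in> carrier Fn" "gen 1 \<in> carrier Fn"
  using n by (auto intro!: gen_closed)

lemma common_power: "\<exists>k>0. \<forall>i<2. gen i [^]\<^bsub>Fn\<^esub> (k::nat) \<in> shift_stab"
proof -
  obtain k l :: nat where k: "k > 0" "gen 0 [^]\<^bsub>Fn\<^esub> k \<in> shift_stab"
    and l: "l > 0" "gen 1 [^]\<^bsub>Fn\<^esub> l \<in> shift_stab"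
    using Fn.finite_index_power[OF shift_stab_subgroup shift_stab_finite_index] gen_n by blast
  have "x [^]\<^bsub>Fn\<^esub> m \<in> shift_stab" if "x \<in> shift_stab" for x and m :: nat
    using that Fn.subgroup_int_pow_closed[OF shift_stab_subgroup that, of "int m"] by (simp add: int_pow_int)
  from this[OF k(2), of l] this[OF l(2), of k]
  have "gen 0 [^]\<^bsub>Fn\<^esub> (k * l) \<in> shift_stab" "gen 1 [^]\<^bsub>Fn\<^esub> (k * l) \<in> shift_stab"
    using gen_n by (simp_all add: Fn.nat_pow_pow mult.commute)
  then show ?thesis using k l by (intro exI[of _ "k * l"]) (auto simp: less_2_cases_iff One_nat_def)
qed

text \<open>The subgroup of finite index is \<open>sgn_ker \<rtimes> Q\<close> with \<open>Q\<close> the full stabiliser of \<open>shift\<close>. The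
  character of the quotient is the exponent sum, which is positive on a power of a generator that
  lies in \<open>Q\<close>.\<close>
theorem virtually_fibers: "virtually_algebraically_fibers G"
proof -
  note Q = shift_stab_subgroup subset_refl[of shift_stab]
  interpret A: group "G\<lparr>carrier := sgn_ker_by shift_stab\<rparr>" by (rule sgn_ker_by_group[OF Q])
  obtain S where S: "finite S" "S \<subseteq> sgn_ker" "generate F2 S = sgn_ker"
    using sgn_ker_finitely_generated by blast
  obtain T where T: "finite T" "T \<subseteq> shift_stab" "generate Fn T = shift_stab"
    using Fn.finite_index_generators[of "gen ` {..<n}", OF _ _ generate_gen shift_stab_subgroup shift_stab_finite_index]
    by (auto intro: gen_closed)
  obtain k :: nat where k: "k > 0" "gen 0 [^]\<^bsub>Fn\<^esub> k \<in> shift_stab"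
    using common_power by auto
  have one: "\<one>\<^bsub>F2\<^esub> \<in> sgn_ker" "\<one>\<^bsub>Fn\<^esub> \<in> shift_stab"
    using subgroup.one_closed subgroup_sgn_ker shift_stab_subgroup by blast+
  have "algebraically_fibers (G\<lparr>carrier := sgn_ker_by shift_stab\<rparr>)"
  proof (rule A.algebraically_fibers_if_excessive[OF base_normal[OF Q] _ _ _ shift_hom[OF Q] _ _
        snd_hom[OF Q expsum(1)] _ _ _ sgn_ker_by_generated[OF Q T(2,3)]])
    show "finite (base S)" using S by (simp add: base_def)
    show "generate (G\<lparr>carrier := sgn_ker_by shift_stab\<rparr>) (base S) = base sgn_ker"
      using base_generated[OF Q S(2)] S(3) by simp
    show "base S \<subseteq> carrier (G\<lparr>carrier := sgn_ker_by shift_stab\<rparr>)"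
      using base_generated(1)[OF Q S(2)] by simp
    show "(gen_b, \<one>\<^bsub>Fn\<^esub>) \<in> base sgn_ker" using gen_b_ker by (simp add: base_def)
    show "(\<one>\<^bsub>F2\<^esub>, gen 0 [^]\<^bsub>Fn\<^esub> k) \<in> carrier (G\<lparr>carrier := sgn_ker_by shift_stab\<rparr>)"
      using k one by (simp add: sgn_ker_by_def)
    show "0 < expsum (snd (\<one>\<^bsub>F2\<^esub>, gen 0 [^]\<^bsub>Fn\<^esub> k))" using n k by (simp add: expsum_pow)
    show "(\<lambda>q. (\<one>\<^bsub>F2\<^esub>, q)) ` T \<subseteq> carrier (G\<lparr>carrier := sgn_ker_by shift_stab\<rparr>)"
      using T one by (auto simp: sgn_ker_by_def)
  qed (use T Fn.hom_integer_group(3)[OF expsum(1)] in \<open>auto simp: base_def\<close>)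
  then show ?thesis
    using sgn_ker_by_subgroup[OF Q] sgn_ker_by_finite_index[OF Q shift_stab_finite_index]
    by (auto simp: virtually_algebraically_fibers_def)
qed

text \<open>Here \<open>Q\<close> is generated by common powers of two basis elements. It need not have finite index, but it is
  free on these two powers, as the amalgam argument requires.\<close>
theorem incoherent: "incoherent G"
proof -
  obtain k :: nat where k: "k > 0" "\<And>i. i < 2 \<Longrightarrow> gen i [^]\<^bsub>Fn\<^esub> k \<in> shift_stab"
    using common_power by auto
  have "{..<2} \<subseteq> {..<n}" using n by auto
  from free_group_power_embedding[OF this k(1)]
  obtain \<iota> where \<iota>: "\<iota> \<in> hom F2 Fn" "inj_on \<iota> (carrier F2)"
    "\<And>i. i < 2 \<Longrightarrow> \<iota> (gen i) = gen i [^]\<^bsub>Fn\<^esub> k" by auto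
  interpret \<iota>: group_hom F2 Fn \<iota>
    using \<iota>(1) by (simp add: group_hom_def group_hom_axioms_def F2.is_group Fn.is_group)
  define Q where "Q = \<iota> ` carrier F2"
  have Q1: "subgroup Q Fn" unfolding Q_def by (rule \<iota>.img_is_subgroup)
  have "Q = generate Fn (\<iota> ` gen ` {..<2})"
    unfolding Q_def generate_gen[symmetric] by (rule \<iota>.generate_img[symmetric]) (auto intro: gen_closed)
  also have "\<dots> \<subseteq> shift_stab"
    using \<iota>(3) k(2) by (intro Fn.generate_subgroup_incl shift_stab_subgroup) auto
  finally have Q2: "Q \<subseteq> shift_stab" .
  note Q = Q1 Q2
  interpret A: group "G\<lparr>carrier := sgn_ker_by Q\<rparr>" by (rule sgn_ker_by_group[OF Q])
  obtain S where S: "finite S" "S \<subseteq> sgn_ker" "generate F2 S = sgn_ker"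
    using sgn_ker_finitely_generated by blast
  note baseS = base_generated[OF Q S(2), unfolded S(3)]
  define \<pi> where "\<pi> z = inv_into (carrier F2) \<iota> (snd z)" for z :: "nat word \<times> nat word"
  have \<pi>: "\<pi> (x, \<iota> w) = w" if "w \<in> carrier F2" for x w
    using that \<iota>(2) by (simp add: \<pi>_def)
  have one: "\<one>\<^bsub>F2\<^esub> \<in> sgn_ker" using subgroup.one_closed subgroup_sgn_ker by blast
  have "incoherent (G\<lparr>carrier := sgn_ker_by Q\<rparr>)"
  proof (rule A.incoherent_if_excessive[where S = "base S" and \<pi> = \<pi> and s = "(gen_b, \<one>\<^bsub>Fn\<^esub>)"
        and t = "\<lambda>i. (\<one>\<^bsub>F2\<^esub>, gen i [^]\<^bsub>Fn\<^esub> k)", OF _ _ _ _ shift_hom[OF Q] _ _ snd_hom[OF Q expsum(1)],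
        unfolded baseS(2)])
    show "finite (base S)" using S by (simp add: base_def)
    show "base S \<subseteq> carrier (G\<lparr>carrier := sgn_ker_by Q\<rparr>)" using baseS(1) by simp
    show "base sgn_ker = kernel (G\<lparr>carrier := sgn_ker_by Q\<rparr>) F2 \<pi>"
    proof -
      have "\<pi> (x, q) = \<one>\<^bsub>F2\<^esub> \<longleftrightarrow> q = \<one>\<^bsub>Fn\<^esub>" if "q \<in> Q" for x q
        using that \<pi> \<iota>.hom_one F2.one_closed unfolding Q_def by (metis imageE)
      then show ?thesis
        using subgroup.one_closed[OF Q1] by (auto simp: kernel_def base_def sgn_ker_by_def)
    qed
    show "\<pi> \<in> hom (G\<lparr>carrier := sgn_ker_by Q\<rparr>) F2"
    proof (rule homI)
      fix z assume "z \<in> carrier (G\<lparr>carrier := sgn_ker_by Q\<rparr>)"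
      then obtain x v where z: "z = (x, \<iota> v)" "v \<in> carrier F2" by (auto simp: sgn_ker_by_def Q_def)
      then show "\<pi> z \<in> carrier F2" by (simp add: \<pi>)
      fix z' assume "z' \<in> carrier (G\<lparr>carrier := sgn_ker_by Q\<rparr>)"
      then obtain x' v' where z': "z' = (x', \<iota> v')" "v' \<in> carrier F2" by (auto simp: sgn_ker_by_def Q_def)
      show "\<pi> (z \<otimes>\<^bsub>G\<lparr>carrier := sgn_ker_by Q\<rparr>\<^esub> z') = \<pi> z \<otimes>\<^bsub>F2\<^esub> \<pi> z'"
        using z z' by (simp add: mult_G \<pi> flip: \<iota>.hom_mult)
    qed
    show "(gen_b, \<one>\<^bsub>Fn\<^esub>) \<in> base sgn_ker" using gen_b_ker by (simp add: base_def)
    show "expsum (snd z) = 0" if "z \<in> base sgn_ker" for z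
      using that Fn.hom_integer_group(3)[OF expsum(1)] by (auto simp: base_def)
    fix i :: nat assume i: "i < 2"
    have gi: "gen i \<in> carrier F2" using i by (intro gen_closed) simp
    show "(\<one>\<^bsub>F2\<^esub>, gen i [^]\<^bsub>Fn\<^esub> k) \<in> carrier (G\<lparr>carrier := sgn_ker_by Q\<rparr>)"
      using one gi by (simp add: sgn_ker_by_def Q_def flip: \<iota>(3)[OF i])
    show "\<pi> (\<one>\<^bsub>F2\<^esub>, gen i [^]\<^bsub>Fn\<^esub> k) = gen i"
      using gi by (simp add: \<pi> flip: \<iota>(3)[OF i])
    show "0 < expsum (snd (\<one>\<^bsub>F2\<^esub>, gen i [^]\<^bsub>Fn\<^esub> k))" using n k i by (simp add: expsum_pow)
  qed (use base_not_finitely_generated[OF Q] in simp_all)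
  then show ?thesis using G.coherent_subgroup[OF sgn_ker_by_subgroup[OF Q]] by blast
qed

end

theorem theorem6p1:
  fixes n :: nat and \<phi> :: "nat word \<Rightarrow> nat word \<Rightarrow> nat word"
  assumes "n \<ge> 2"
    and "\<phi> \<in> hom (free_group {..<n}) (AutoGroup (free_group {..<2}))"
  shows "incoherent (semidirect (free_group {..<2}) \<phi> (free_group {..<n})) \<and>
    virtually_algebraically_fibers (semidirect (free_group {..<2}) \<phi> (free_group {..<n}))"
proof -
  interpret F2_by_free n \<phi> using assms by (rule F2_by_free.intro)
  show ?thesis using incoherent virtually_fibers by (rule conjI)
qed

end
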